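(* Let $\{X(t);t\ge 0\}$ be a (regular) weighted Markov branching process with $X(0)=1$, let $m>1$ be a fixed integer with $b_m>0$, let $\tau=\inf\{t\ge0:X(t)=0\}$, and assume $P(\tau<\infty)>0$. Let $Y_m(\tau)$ be the $(m-1)$-range up-crossing number until extinction. Then the probability generating function $G(v)=E[v^{Y_m(\tau)}\mid\tau<\infty]$ is $$G(v)=\rho^{-1}\sum_{k=0}^\infty\rho_kv^k,$$ and hence $$P(Y_m(\tau)=k\mid\tau<\infty)=\rho^{-1}\rho_k,\qquad k\ge0,$$ where $\rho$ is the minimal nonnegative root of $B(u)=0$, $\rho_0$ is the minimal nonnegative root of $B_m(u)=\sum_{j\ne m}b_ju^j=0$, and $\rho_k$ $(k\ge1)$ are given by the recursion $$\rho_1=-\frac{b_m\rho_0^m}{B_m'(\rho_0)},\qquad \rho_{k+1}=-\frac{\displaystyle\sum_{i\ne 1,m}b_i\sum_{\substack{j_1+\cdots+j_i=k+1\\ j_1,\dots,j_i\le k}}\rho_{j_1}\cdots\rho_{j_i}+b_m\rho^{*(m)}_k}{B_m'(\rho_0)},\quad k\ge1.$$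
   Context: $\mathbb{Z}_+=\{0,1,2,\dots\}$. Fix real numbers $b_j$ $(j\ge 0)$ and $w_i$ $(i\ge 1)$ with $b_j\ge 0$ for $j\ne 1$, $0<-b_1=\sum_{j\ne 1}b_j<\infty$, and $w_i>0$. The weighted branching $Q$-matrix is $q_{ij}=w_ib_{j-i+1}$ if $i\ge 1$, $j\ge i-1$, and $q_{ij}=0$ otherwise $(i,j\in\mathbb{Z}_+)$. A weighted Markov branching process $X(t)$ is the continuous-time Markov chain on $\mathbb{Z}_+$ with this $Q$-matrix; it is assumed regular (non-explosive). State $0$ is absorbing. $Y_m(t)$ is the number of jumps of size $m-1$ made by $X$ during $[0,t]$, $Y_m(0)=0$; $Y_m(\tau)$ is the total number of such jumps until extinction. $B(u)=\sum_{j\ge 0}b_ju^j$ for $u\in[0,1]$. In the recursion, $i$ runs over $\mathbb{Z}_+\setminus\{1,m\}$, the $j_1,\dots,j_i$ are in $\mathbb{Z}_+$, and the inner sum is $0$ for $i=0$. Convolution power: $\rho^{*(m)}_{k}=\sum_{l_1+\cdots+l_m=k}\rho_{l_1}\cdots\rho_{l_m}$, over $(l_1,\dots,l_m)\in\mathbb{Z}_+^m$. *)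

theory Defs
  imports "HOL-Probability.Probability"
begin

definition branching_rates :: "(nat \<Rightarrow> real) \<Rightarrow> (nat \<Rightarrow> real) \<Rightarrow> bool" where
  "branching_rates b w \<longleftrightarrow>
     (\<forall>j. j \<noteq> 1 \<longrightarrow> 0 \<le> b j) \<and> 0 < - b 1 \<and>
     (\<lambda>j. if j = 1 then 0 else b j) sums (- b 1) \<and>
     (\<forall>i\<ge>1. 0 < w i)"

definition branching_Q :: "(nat \<Rightarrow> real) \<Rightarrow> (nat \<Rightarrow> real) \<Rightarrow> nat \<Rightarrow> nat \<Rightarrow> real" where
  "branching_Q b w i j = (if 1 \<le> i \<and> i - 1 \<le> j then w i * b (j + 1 - i) else 0)"

text \<open>Honest (row sums equal to one) transition functions on the natural numbers.\<close>

definition transition_function :: "(real \<Rightarrow> nat \<Rightarrow> nat \<Rightarrow> real) \<Rightarrow> bool" where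
  "transition_function p \<longleftrightarrow>
     (\<forall>t\<ge>0. \<forall>i j. 0 \<le> p t i j) \<and>
     (\<forall>t\<ge>0. \<forall>i. p t i sums 1) \<and>
     (\<forall>i j. p 0 i j = (if i = j then 1 else 0)) \<and>
     (\<forall>s\<ge>0. \<forall>t\<ge>0. \<forall>i j. (\<lambda>k. p s i k * p t k j) sums p (s + t) i j)"

definition has_Q_matrix ::
    "(real \<Rightarrow> nat \<Rightarrow> nat \<Rightarrow> real) \<Rightarrow> (nat \<Rightarrow> nat \<Rightarrow> real) \<Rightarrow> bool" where
  "has_Q_matrix p Q \<longleftrightarrow>
     (\<forall>i j. ((\<lambda>t. p t i j) has_real_derivative Q i j) (at 0 within {0..}))"

text \<open>The Markov property in elementary form, multiplied out so that
  conditioning on a null event is harmless.\<close>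

definition markov_property ::
    "'a measure \<Rightarrow> (real \<Rightarrow> 'a \<Rightarrow> nat) \<Rightarrow> (real \<Rightarrow> nat \<Rightarrow> nat \<Rightarrow> real) \<Rightarrow> bool" where
  "markov_property M X p \<longleftrightarrow>
     (\<forall>n (t :: nat \<Rightarrow> real) (i :: nat \<Rightarrow> nat).
        0 \<le> t 0 \<and> (\<forall>k\<le>n. t k < t (Suc k)) \<longrightarrow>
        \<P>(\<omega> in M. \<forall>k\<le>Suc n. X (t k) \<omega> = i k) =
        \<P>(\<omega> in M. \<forall>k\<le>n. X (t k) \<omega> = i k) * p (t (Suc n) - t n) (i n) (i (Suc n)))"

text \<open>Since \<open>nat\<close> carries the discrete topology, such a path is a right-continuous
  step function with finitely many jumps in every bounded time interval;
  this is non-explosion on the level of paths.\<close>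

definition regular_path :: "(real \<Rightarrow> nat) \<Rightarrow> bool" where
  "regular_path x \<longleftrightarrow>
     (\<forall>t\<ge>0. continuous (at_right t) x) \<and>
     (\<forall>t\<ge>0. finite {s. 0 < s \<and> s \<le> t \<and> \<not> isCont x s})"

definition regular_markov_chain ::
    "'a measure \<Rightarrow> (real \<Rightarrow> 'a \<Rightarrow> nat) \<Rightarrow> (nat \<Rightarrow> nat \<Rightarrow> real) \<Rightarrow> bool" where
  "regular_markov_chain M X Q \<longleftrightarrow>
     prob_space M \<and>
     (\<forall>t\<ge>0. X t \<in> measurable M (count_space UNIV)) \<and>
     (\<forall>\<omega>\<in>space M. regular_path (\<lambda>t. X t \<omega>)) \<and>
     (\<exists>p. transition_function p \<and> has_Q_matrix p Q \<and> markov_property M X p)"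

definition weighted_branching_process ::
    "'a measure \<Rightarrow> (real \<Rightarrow> 'a \<Rightarrow> nat) \<Rightarrow> (nat \<Rightarrow> real) \<Rightarrow> (nat \<Rightarrow> real) \<Rightarrow> bool" where
  "weighted_branching_process M X b w \<longleftrightarrow>
     branching_rates b w \<and> regular_markov_chain M X (branching_Q b w)"

text \<open>The infimum is taken in the extended reals, so it is \<open>\<infinity>\<close> without extinction.\<close>

definition extinction_time :: "(real \<Rightarrow> 'a \<Rightarrow> nat) \<Rightarrow> 'a \<Rightarrow> ereal" where
  "extinction_time X \<omega> = (INF t\<in>{t. 0 \<le> t \<and> X t \<omega> = 0}. ereal t)"

definition jump_at :: "(real \<Rightarrow> nat) \<Rightarrow> int \<Rightarrow> real \<Rightarrow> bool" where
  "jump_at x d s \<longleftrightarrow> (\<exists>l. (x \<longlongrightarrow> l) (at_left s) \<and> int (x s) - int l = d)"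

text \<open>\<open>crossings X m T \<omega>\<close> is the number \<open>Y\<^sub>m(T)\<close> of jumps of size \<open>m - 1\<close> up to the
  possibly infinite time \<open>T\<close>. It is meaningful whenever there are finitely many of them, in
  particular for \<open>T < \<infinity>\<close> on regular paths.\<close>

definition crossings :: "(real \<Rightarrow> 'a \<Rightarrow> nat) \<Rightarrow> nat \<Rightarrow> ereal \<Rightarrow> 'a \<Rightarrow> nat" where
  "crossings X m T \<omega> =
     card {s. 0 < s \<and> ereal s \<le> T \<and> jump_at (\<lambda>t. X t \<omega>) (int m - 1) s}"

definition total_crossings :: "(real \<Rightarrow> 'a \<Rightarrow> nat) \<Rightarrow> nat \<Rightarrow> 'a \<Rightarrow> nat" where
  "total_crossings X m \<omega> = crossings X m (extinction_time X \<omega>) \<omega>"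

definition B_fun :: "(nat \<Rightarrow> real) \<Rightarrow> real \<Rightarrow> real" where
  "B_fun b u = (\<Sum>j. b j * u ^ j)"

definition Bm_fun :: "(nat \<Rightarrow> real) \<Rightarrow> nat \<Rightarrow> real \<Rightarrow> real" where
  "Bm_fun b m u = (\<Sum>j. if j = m then 0 else b j * u ^ j)"

text \<open>The generating functions are only considered on the unit interval.\<close>

definition min_nonneg_root :: "(real \<Rightarrow> real) \<Rightarrow> real" where
  "min_nonneg_root f = (LEAST u. 0 \<le> u \<and> u \<le> 1 \<and> f u = 0)"

text \<open>Tuples \<open>(j\<^sub>1, \<dots>, j\<^sub>i)\<close> are lists of length \<open>i\<close>. The last equation is the recursion for
  index \<open>k + 1\<close> with \<open>k = Suc n\<close>. For \<open>i = 0\<close> its inner sum is empty, as the only list of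
  length \<open>0\<close> has sum \<open>0\<close>.\<close>

function rho_seq :: "(nat \<Rightarrow> real) \<Rightarrow> nat \<Rightarrow> nat \<Rightarrow> real" where
  "rho_seq b m 0 = min_nonneg_root (Bm_fun b m)"
| "rho_seq b m (Suc 0) =
     - (b m * rho_seq b m 0 ^ m) / deriv (Bm_fun b m) (rho_seq b m 0)"
| "rho_seq b m (Suc (Suc n)) =
     - ((\<Sum>i. if i = 1 \<or> i = m then 0
              else b i * (\<Sum>js\<in>{js. length js = i \<and> sum_list js = Suc (Suc n) \<and>
                                  (\<forall>j\<in>set js. j \<le> Suc n)}.
                          prod_list (map (\<lambda>j. rho_seq b m j) js)))
        + b m * (\<Sum>js\<in>{js. length js = m \<and> sum_list js = Suc n}.
                   prod_list (map (\<lambda>j. rho_seq b m j) js)))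
     / deriv (Bm_fun b m) (rho_seq b m 0)"
  by pat_completeness auto
termination
  by (relation "Wellfounded.measure (\<lambda>(b, m, k). k)") (auto dest: member_le_sum_list simp: less_Suc_eq_le)

end

theory Submission
  imports Defs "HOL-Computational_Algebra.Formal_Power_Series"
begin

text \<open>
  Put \<open>B\<^sub>v(u) = B\<^sub>m(u) + v b\<^sub>m u\<^sup>m\<close> and let \<open>F(v)\<close> be the expectation of
  \<open>v\<close> to the power of the number of crossings, over the event of extinction. The weights \<open>w\<^sub>i\<close> only
  multiply rows of the generator, so harmonicity of \<open>u\<^sup>i\<close> for the generator with the
  jumps of size \<open>m - 1\<close> weighted by \<open>v\<close> amounts to \<open>B\<^sub>v(u) = 0\<close>. Observing
  the chain at the times \<open>k T / n\<close> and killing it above a level \<open>N\<close> leaves powers of a finite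
  matrix \<open>I + h Q + o(h)\<close>, to which super- and subharmonic functions can be applied before
  \<open>n\<close>, \<open>T\<close> and \<open>N\<close> go to infinity. This gives \<open>F(v) \<le> u\<close> whenever
  \<open>B\<^sub>v(u) \<le> 0\<close>, and \<open>F(v) \<ge> f\<close> for a root \<open>f\<close> of \<open>B\<^sub>v\<close> in
  \<open>(0, 1)\<close>. Hence \<open>B\<^sub>v(F(v)) = 0\<close>; the cases \<open>v = 0\<close> and \<open>v = 1\<close> are
  the two minimal roots, and comparing coefficients in \<open>v\<close> is the recursion.
\<close>

subsection \<open>Regular paths on a time grid\<close>

text \<open>The hypotheses give finite-dimensional distributions and the derivative at 0 of each
  single entry of \<open>p\<close>. These derivatives need not be uniform over the states, so the
  state space is cut to {0..N} while the mesh still tends to 0: then only finitely many o(h) errors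
  occur. A strict inequality for the generator absorbs them into a one-step bound with factor 1 + c
  h, and iterating this bound needs only the elementary Markov property. The lower bound is the
  harder half. The functional sees only paths that are at 0 at time T, so paths still alive inside
  {1..N} have to be shown negligible, and those leaving {0..N} are lost. The function that pays for
  the loss, f^i - f^(N+1), vanishes identically for f = 1. Hence v < 1 is treated first, where
  B_v(1) = -(1 - v) b_m < 0 keeps the root away from 1, and v = 1 follows by continuity.\<close>

lemma regular_path_const:
  assumes x: "regular_path x" and "0 \<le> a" "a \<le> c" "\<forall>s. a < s \<and> s \<le> c \<longrightarrow> isCont x s"
  shows "x c = x a"
proof -
  \<comment> \<open>Read as a real function, the path is continuous on an interval with values at
    mutual distance at least 1, hence constant by connectedness.\<close>
  have "continuous_on {a..c} (\<lambda>t. real (x t))"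
  proof (cases "a < c")
    case True
    have "continuous (at s within {a..c}) x" if "s \<in> {a..c}" for s
    proof (cases "s = a")
      case True
      have "continuous (at_right a) x" using x \<open>0 \<le> a\<close> by (auto simp: regular_path_def)
      then show ?thesis
        using \<open>s = a\<close> \<open>a < c\<close> by (simp add: continuous_within at_within_Icc_at_right)
    next
      case False
      then have "isCont x s" using that assms(4) by auto
      then show ?thesis using continuous_at_imp_continuous_at_within by blast
    qed
    then have "continuous_on {a..c} x" by (simp add: continuous_on_eq_continuous_within)
    then show ?thesis by (intro continuous_intros)
  qed (use assms in auto)
  then have "(\<lambda>t. real (x t)) constant_on {a..c}"
  proof (rule continuous_discrete_range_constant[rotated])
    fix s assume "s \<in> {a..c}"
    show "\<exists>e>0. \<forall>y. y \<in> {a..c} \<and> real (x y) \<noteq> real (x s) \<longrightarrow> e \<le> norm (real (x y) - real (x s))"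
      by (rule exI[of _ 1]) (auto simp: of_nat_diff abs_if)
  qed auto
  then obtain y where "\<forall>t\<in>{a..c}. real (x t) = y" by (auto simp: constant_on_def)
  then have "real (x c) = real (x a)" using \<open>a \<le> c\<close> by simp
  then show ?thesis by simp
qed

lemma regular_path_left_limit:
  assumes x: "regular_path x" and "0 \<le> a" "a < s" "\<forall>r. a < r \<and> r < s \<longrightarrow> isCont x r"
  shows "(x \<longlongrightarrow> x a) (at_left s)"
proof -
  have "\<forall>\<^sub>F r in at_left s. a < r \<and> r < s"
    using \<open>a < s\<close> by (auto simp: eventually_at_left_field)
  then have "\<forall>\<^sub>F r in at_left s. x a = x r"
    by eventually_elim (rule regular_path_const[OF x \<open>0 \<le> a\<close>, symmetric], use assms in auto)
  then show ?thesis by (rule tendsto_eventually[OF eventually_mono]) auto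
qed

text \<open>Without discontinuities strictly between \<open>a\<close> and \<open>s\<close> the left
  limit at \<open>s\<close> is \<open>x a\<close>, so the jump is an increment between two fixed
  times.\<close>

lemma jump_at_iff:
  assumes x: "regular_path x" and "0 \<le> a" "a < s" "\<forall>r. a < r \<and> r < s \<longrightarrow> isCont x r"
  shows "jump_at x d s \<longleftrightarrow> int (x s) - int (x a) = d"
  using regular_path_left_limit[OF assms] tendsto_unique[of "at_left s" x]
  by (auto simp: jump_at_def)

lemma jump_at_not_isCont:
  assumes "jump_at x d s" "d \<noteq> 0"
  shows "\<not> isCont x s"
proof
  assume "isCont x s"
  then have "(x \<longlongrightarrow> x s) (at_left s)"
    by (simp add: continuous_at_imp_continuous_at_within continuous_within [symmetric])
  then show False using assms tendsto_unique[of "at_left s" x] by (auto simp: jump_at_def)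
qed

lemma regular_path_right_const:
  assumes x: "regular_path x" and "0 \<le> t"
  shows "\<forall>\<^sub>F s in at_right t. x s = x t"
proof -
  have "(x \<longlongrightarrow> x t) (at_right t)"
    using assms by (auto simp: regular_path_def continuous_within)
  then show ?thesis by (simp add: tendsto_discrete)
qed

text \<open>A finite set has a positive smallest gap. Applied to the discontinuities in a bounded
  interval, it puts at most one of them into each grid cell.\<close>

lemma eventually_grid_gap:
  fixes D :: "real set"
  assumes "finite D"
  shows "\<forall>\<^sub>F n in sequentially. \<forall>s\<in>D. \<forall>r\<in>D. s < r \<longrightarrow> s + T / real n < r"
proof -
  have "\<forall>\<^sub>F n in sequentially. s < r \<longrightarrow> s + T / real n < r" for s r
  proof (cases "s < r")
    case True
    have "(\<lambda>n. s + T / real n) \<longlonglongrightarrow> s + 0"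
      by (intro tendsto_intros lim_const_over_n)
    from order_tendstoD(2)[OF this, of r] True show ?thesis by simp
  qed auto
  then show ?thesis using assms by (simp add: eventually_ball_finite)
qed

section \<open>The grid and its half-open cells\<close>

definition grid :: "real \<Rightarrow> nat \<Rightarrow> nat \<Rightarrow> real" where
  "grid T n k = real k * (T / real n)"

lemma grid_Suc: "grid T n (Suc k) = grid T n k + T / real n"
  by (simp add: grid_def distrib_right add_divide_distrib)

lemma grid_cell:
  assumes "0 < T" "0 < n" "0 < s" "s \<le> T"
  obtains k where "k < n" "grid T n k < s" "s \<le> grid T n (Suc k)"
proof -
  define h where "h = T / real n"
  have h: "0 < h" "real n * h = T" using assms by (auto simp: h_def)
  define k where "k = nat (\<lceil>s / h\<rceil> - 1)"
  have c: "1 \<le> \<lceil>s / h\<rceil>" using assms h by (simp add: le_ceiling_iff)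
  then have k: "real k = of_int \<lceil>s / h\<rceil> - 1" by (simp add: k_def of_nat_nat)
  have "s / h \<le> real n" using assms h by (simp add: field_simps)
  then have "\<lceil>s / h\<rceil> \<le> int n" by (simp add: ceiling_le_iff)
  then have "k < n" using c k_def by linarith
  moreover have "real k < s / h" "s / h \<le> real k + 1" unfolding k by linarith+
  then have "real k * h < s" "s \<le> real (Suc k) * h"
    using h by (simp_all add: field_simps)
  ultimately show ?thesis using that by (simp add: grid_def h_def)
qed

lemma grid_mono: "0 < T \<Longrightarrow> k \<le> l \<Longrightarrow> grid T n k \<le> grid T n l"
  by (auto simp: grid_def intro!: divide_right_mono mult_right_mono)

lemma grid_bounds: "0 < T \<Longrightarrow> k \<le> n \<Longrightarrow> 0 \<le> grid T n k \<and> grid T n k \<le> T"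
  by (cases "n = 0") (auto simp: grid_def field_simps)

lemma grid_cell_unique:
  assumes "0 < T" "grid T n k < s" "s \<le> grid T n (Suc k)" "grid T n l < s" "s \<le> grid T n (Suc l)"
  shows "k = l"
proof -
  have "\<not> Suc k \<le> l" "\<not> Suc l \<le> k"
    using assms grid_mono[OF \<open>0 < T\<close>, of "Suc k" l n] grid_mono[OF \<open>0 < T\<close>, of "Suc l" k n]
    by linarith+
  then show ?thesis by simp
qed

text \<open>Each value is held from one discontinuity to the next, and on a fine grid the first grid
  point at or after a discontinuity comes before the next one. This turns killing at grid times into
  killing in continuous time.\<close>

lemma regular_path_grid_sees_values:
  assumes x: "regular_path x" and T: "0 < T"
  shows "\<forall>\<^sub>F n in sequentially. (\<forall>k\<le>n. P (x (grid T n k))) \<longleftrightarrow> (\<forall>t\<in>{0..T}. P (x t))"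
proof -
  let ?D = "{s. 0 < s \<and> s \<le> T \<and> \<not> isCont x s}"
  have fin: "finite ?D" using x T by (auto simp: regular_path_def)
  show ?thesis
    using eventually_grid_gap[OF fin, of T] eventually_gt_at_top[of 0]
  proof eventually_elim
    case (elim n)
    show ?case
    proof (intro iffI ballI)
      assume L: "\<forall>k\<le>n. P (x (grid T n k))"
      have P0: "P (x 0)" using L[rule_format, of 0] by (simp add: grid_def)
      fix t assume t: "t \<in> {0..T}"
      show "P (x t)"
      proof (cases "\<exists>s\<in>?D. s \<le> t")
        case False
        then have "isCont x s" if "0 < s" "s \<le> t" for s
          proof -
            from that t have "s \<le> T" by auto
            show ?thesis by (rule ccontr) (use False that \<open>s \<le> T\<close> in blast)
          qed
        then have "x t = x 0" using t by (intro regular_path_const[OF x]) auto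
        then show ?thesis using P0 by simp
      next
        case True
        define s where "s = Max {s \<in> ?D. s \<le> t}"
        have fs: "finite {s \<in> ?D. s \<le> t}" using fin by (rule rev_finite_subset) auto
        have "s \<in> {s \<in> ?D. s \<le> t}" unfolding s_def using fs True by (intro Max_in) auto
        then have s: "s \<in> ?D" "s \<le> t" by auto
        have smax: "r \<le> s" if "r \<in> ?D" "r \<le> t" for r
          unfolding s_def using fs that by (intro Max_ge) auto
        have "isCont x r" if "s < r" "r \<le> t" for r
        proof (rule ccontr)
          assume "\<not> isCont x r"
          then have "r \<le> s" using that s t by (intro smax) auto
          then show False using that by simp
        qed
        then have "x t = x s" using s t by (intro regular_path_const[OF x]) auto
        obtain k where k: "k < n" "grid T n k < s" "s \<le> grid T n (Suc k)"
          using grid_cell[OF T, of n s] s elim by auto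
        have "grid T n (Suc k) \<le> T" using grid_bounds[OF T, of "Suc k" n] k by auto
        have "isCont x r" if "s < r" "r \<le> grid T n (Suc k)" for r
        proof (rule ccontr)
          assume "\<not> isCont x r"
          then have "r \<in> ?D" using that s \<open>grid T n (Suc k) \<le> T\<close> by auto
          then have "s + T / real n < r" using elim(1) s(1) that(1) by blast
          then show False using that k by (simp add: grid_Suc)
        qed
        then have "x s = x (grid T n (Suc k))"
          by (intro regular_path_const[OF x, symmetric]) (use k s in auto)
        then show ?thesis using L k \<open>x t = x s\<close> by simp
      qed
    qed (use grid_bounds[OF T] in auto)
  qed
qed

text \<open>On a fine grid a cell holds at most one discontinuity, so its increment is that jump.
  The bound \<open>\<sigma>\<close> will be the extinction time or \<infinity>. A jump exactly at
  \<open>\<sigma>\<close> would be missed when its cell ends after \<open>\<sigma>\<close>, which is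
  what the last assumption excludes.\<close>

lemma eventually_grid_count:
  assumes x: "regular_path x" and T: "0 < T" and d: "d \<noteq> 0"
    and \<sigma>: "\<And>s. ereal s = \<sigma> \<Longrightarrow> \<not> jump_at x d s"
  shows "\<forall>\<^sub>F n in sequentially.
    card {k. k < n \<and> ereal (grid T n (Suc k)) \<le> \<sigma> \<and> int (x (grid T n (Suc k))) - int (x (grid T n k)) = d} =
    card {s. 0 < s \<and> s \<le> T \<and> ereal s \<le> \<sigma> \<and> jump_at x d s}"
proof -
  let ?D = "{s. 0 < s \<and> s \<le> T \<and> \<not> isCont x s}"
  have fin: "finite ?D" using x T by (auto simp: regular_path_def)
  \<comment> \<open>The cell of a jump before \<open>\<sigma>\<close> must also end by
    \<open>\<sigma>\<close>; a finite \<open>\<sigma>\<close> is therefore added to the set whose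
    gaps the mesh has to beat.\<close>
  have ev: "\<forall>\<^sub>F n in sequentially. \<forall>s\<in>?D. ereal s < \<sigma> \<longrightarrow> ereal (s + T / real n) \<le> \<sigma>"
  proof (cases \<sigma>)
    case (real r)
    from eventually_grid_gap[of "insert r ?D" T] fin
    have "\<forall>\<^sub>F n in sequentially. \<forall>s\<in>insert r ?D. \<forall>r\<in>insert r ?D. s < r \<longrightarrow> s + T / real n < r" by simp
    then show ?thesis
    proof eventually_elim
      case (elim n)
      have "s + T / real n \<le> r" if "s \<in> ?D" "s < r" for s
        using elim[rule_format, of s r] that by auto
      then show ?case unfolding real by simp
    qed
  qed auto
  show ?thesis
    using eventually_grid_gap[OF fin, of T] ev eventually_gt_at_top[of 0]
  proof eventually_elim
    case (elim n)
    let ?g = "grid T n"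
    have cell: "jump_at x d s \<longleftrightarrow> int (x (?g (Suc k))) - int (x (?g k)) = d"
      if s: "s \<in> ?D" and k: "k < n" "?g k < s" "s \<le> ?g (Suc k)" for s k
    proof -
      have g: "0 \<le> ?g k" "?g (Suc k) \<le> T"
        using grid_bounds[OF T, of "Suc k" n] grid_bounds[OF T, of k n] k by auto
      have "isCont x r" if "?g k < r" "r < s" for r
      proof (rule ccontr)
        assume "\<not> isCont x r"
        then have "r \<in> ?D" using that g k s by auto
        then have "r + T / real n < s" using elim(1) s that by blast
        then show False using that k by (simp add: grid_Suc)
      qed
      then have "jump_at x d s \<longleftrightarrow> int (x s) - int (x (?g k)) = d"
        by (intro jump_at_iff[OF x]) (use g k in auto)
      moreover have "isCont x r" if "s < r" "r \<le> ?g (Suc k)" for r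
      proof (rule ccontr)
        assume "\<not> isCont x r"
        then have "r \<in> ?D" using that g k s by auto
        then have "s + T / real n < r" using elim(1) s that by blast
        then show False using that k by (simp add: grid_Suc)
      qed
      then have "x (?g (Suc k)) = x s"
        by (intro regular_path_const[OF x]) (use g k s in auto)
      ultimately show ?thesis by simp
    qed
    let ?J = "{s. 0 < s \<and> s \<le> T \<and> ereal s \<le> \<sigma> \<and> jump_at x d s}"
    let ?K = "{k. k < n \<and> ereal (?g (Suc k)) \<le> \<sigma> \<and> int (x (?g (Suc k))) - int (x (?g k)) = d}"
    have JD: "?J \<subseteq> ?D" using jump_at_not_isCont[OF _ d] by auto
    define c where "c s = (SOME k. k < n \<and> ?g k < s \<and> s \<le> ?g (Suc k))" for s
    have c: "c s < n \<and> ?g (c s) < s \<and> s \<le> ?g (Suc (c s))" if "s \<in> ?D" for s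
    proof -
      have "\<exists>k. k < n \<and> ?g k < s \<and> s \<le> ?g (Suc k)"
        using grid_cell[OF T, of n s] that elim(3) by auto
      then show ?thesis unfolding c_def by (rule someI_ex)
    qed
    \<comment> \<open>Injective because a cell cannot hold two discontinuities, onto because an
      increment \<open>d \<noteq> 0\<close> forces a discontinuity in the cell.\<close>
    have "bij_betw c ?J ?K"
      unfolding bij_betw_def
    proof (intro conjI inj_onI subset_antisym subsetI)
      fix s r assume "s \<in> ?J" "r \<in> ?J" and eq: "c s = c r"
      then have sr: "s \<in> ?D" "r \<in> ?D" using JD by auto
      have "\<not> s < r" "\<not> r < s"
        using c[OF sr(1)] c[OF sr(2)] eq elim(1)[rule_format, OF sr] elim(1)[rule_format, OF sr(2,1)]
        by (auto simp: grid_Suc)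
      then show "s = r" by simp
    next
      fix k assume "k \<in> c ` ?J"
      then obtain s where s: "s \<in> ?J" "k = c s" by auto
      have sD: "s \<in> ?D" using s JD by auto
      have "ereal s < \<sigma>" using s(1) \<sigma>[of s] order_le_imp_less_or_eq[of "ereal s" \<sigma>] by blast
      then have "ereal (s + T / real n) \<le> \<sigma>" using elim(2) sD by blast
      moreover have "?g (Suc k) \<le> s + T / real n" using c[OF sD] s by (simp add: grid_Suc)
      ultimately have "ereal (?g (Suc k)) \<le> \<sigma>" 
        using order_trans[of "ereal (?g (Suc k))" "ereal (s + T / real n)" \<sigma>] by simp
      moreover have "int (x (?g (Suc k))) - int (x (?g k)) = d"
        using cell[OF sD, of k] c[OF sD] s by simp
      moreover have "k < n" using c[OF sD] s by simp
      ultimately show "k \<in> ?K" by simp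
    next
      fix k assume k: "k \<in> ?K"
      have g: "0 \<le> ?g k" "?g (Suc k) \<le> T" "?g k < ?g (Suc k)"
        using grid_bounds[OF T, of "Suc k" n] grid_bounds[OF T, of k n] k T by (auto simp: grid_Suc)
      have "\<exists>s. ?g k < s \<and> s \<le> ?g (Suc k) \<and> \<not> isCont x s"
      proof (rule ccontr)
        assume "\<not> ?thesis"
        then have "x (?g (Suc k)) = x (?g k)" using g by (intro regular_path_const[OF x]) auto
        then show False using k d by auto
      qed
      then obtain s where s: "?g k < s" "s \<le> ?g (Suc k)" "\<not> isCont x s" by auto
      then have sD: "s \<in> ?D" using g by auto
      have cs: "c s = k" using c[OF sD] s by (intro grid_cell_unique[OF T, of n _ s]) simp_all
      have "ereal s \<le> ereal (?g (Suc k))" using s by simp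
      moreover have "ereal (?g (Suc k)) \<le> \<sigma>" using k by (elim CollectE conjE)
      ultimately have "ereal s \<le> \<sigma>" by (rule order_trans)
      moreover have "jump_at x d s" using cell[OF sD, of k] s k by simp
      ultimately have sJ: "s \<in> ?J" using sD by simp
      show "k \<in> c ` ?J" using cs sJ by (rule image_eqI[OF sym])
    qed
    then have "card ?J = card ?K" by (rule bij_betw_same_card)
    then show ?case by (rule sym)
  qed
qed

text \<open>Right continuity keeps the value for a while. This reduces statements about all times to
  countably many rational ones.\<close>

lemma regular_path_rat_after:
  assumes x: "regular_path x" and "0 \<le> s" "s < t"
  obtains q :: rat where "s < of_rat q" "of_rat q < t" "x (of_rat q) = x s"
proof -
  have "\<forall>\<^sub>F r in at_right s. x r = x s" by (rule regular_path_right_const[OF x \<open>0 \<le> s\<close>])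
  then obtain d where d: "d > s" "\<And>r. s < r \<Longrightarrow> r < d \<Longrightarrow> x r = x s"
    unfolding eventually_at_right_field by blast
  obtain q where "s < of_rat q" "of_rat q < min d t"
    using of_rat_dense[of s "min d t"] d assms by auto
  then show ?thesis using d by (intro that[of q]) auto
qed

lemma regular_path_bounded:
  assumes x: "regular_path x" and T: "0 \<le> T"
  obtains K where "\<And>t. 0 \<le> t \<Longrightarrow> t \<le> T \<Longrightarrow> x t \<le> K"
proof -
  let ?D = "{s. 0 < s \<and> s \<le> T \<and> \<not> isCont x s}"
  have fin: "finite (insert 0 ?D)" using x T by (auto simp: regular_path_def)
  have "x t \<le> Max (x ` insert 0 ?D)" if t: "0 \<le> t" "t \<le> T" for t
  proof -
    define s where "s = Max {s \<in> insert 0 ?D. s \<le> t}"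
    have fs: "finite {s \<in> insert 0 ?D. s \<le> t}" using fin by (rule rev_finite_subset) auto
    have "s \<in> {s \<in> insert 0 ?D. s \<le> t}" unfolding s_def using fs t by (intro Max_in) auto
    then have s: "s \<in> insert 0 ?D" "s \<le> t" "0 \<le> s" by auto
    have "isCont x r" if "s < r" "r \<le> t" for r
    proof (rule ccontr)
      assume "\<not> isCont x r"
      then have "r \<le> s" unfolding s_def using fs that s t by (intro Max_ge) auto
      then show False using that by simp
    qed
    then have "x t = x s" using s by (intro regular_path_const[OF x]) auto
    then show ?thesis using s fin by (intro Max_ge) auto
  qed
  then show ?thesis by (rule that)
qed

lemma eventually_mesh:
  assumes "0 < T" "\<forall>\<^sub>F h in at_right 0. P h"
  shows "\<forall>\<^sub>F n in sequentially. P (T / real n)"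
proof -
  have "filterlim (\<lambda>n. T / real n) (at_right 0) sequentially"
    unfolding filterlim_at
  proof
    show "(\<lambda>n. T / real n) \<longlonglongrightarrow> 0" by (rule lim_const_over_n)
    show "\<forall>\<^sub>F n in sequentially. T / real n \<in> {0<..} \<and> T / real n \<noteq> 0"
      using eventually_gt_at_top[of 0] by eventually_elim (use assms in simp)
  qed
  then show ?thesis using assms(2) by (simp add: filterlim_iff)
qed

text \<open>The slack between \<open>D\<close> and \<open>E\<close> swallows the o(h) remainder. The
  Q-matrix enters all later estimates in this form.\<close>

lemma at_right_lt_linear:
  assumes "(f has_real_derivative D) (at 0 within {0..})" "D < E"
  shows "\<forall>\<^sub>F h in at_right 0. f h < f 0 + E * (h::real)"
proof -
  have "((\<lambda>y. (f y - f 0) / (y - 0)) \<longlongrightarrow> D) (at_right 0)"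
    using assms(1) unfolding has_field_derivative_iff
    by (rule tendsto_within_subset) auto
  then have "\<forall>\<^sub>F h in at_right 0. (f h - f 0) / (h - 0) < E"
    using assms(2) by (rule order_tendstoD)
  with eventually_at_right_less show ?thesis
    by eventually_elim (simp add: field_simps)
qed

subsection \<open>Power series and the recursion\<close>

lemma finite_lists_sum: "finite {js. length js = i \<and> sum_list js = (k::nat)}"
proof (rule finite_subset)
  show "{js. length js = i \<and> sum_list js = k} \<subseteq> {js. set js \<subseteq> {..k} \<and> length js = i}"
    using member_le_sum_list by auto
qed (simp add: finite_lists_length_eq)

lemma sum_lists_eq_fps_power:
  fixes a :: "nat \<Rightarrow> real"
  shows "(\<Sum>js\<in>{js. length js = i \<and> sum_list js = k}. prod_list (map a js)) =
      fps_nth (Abs_fps a ^ i) k"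
proof (induction i arbitrary: k)
  case 0
  have "{js::nat list. length js = 0 \<and> sum_list js = k} = (if k = 0 then {[]} else {})" by auto
  then show ?case by simp
next
  case (Suc i)
  let ?L = "\<lambda>i k. {js::nat list. length js = i \<and> sum_list js = k}"
  have "?L (Suc i) k = (\<lambda>(l, js). l # js) ` (SIGMA l:{0..k}. ?L i (k - l))"
    by (force simp: length_Suc_conv image_iff)
  moreover have "inj_on (\<lambda>(l, js). l # js) (SIGMA l:{0..k}. ?L i (k - l))"
    by (auto simp: inj_on_def)
  ultimately have "(\<Sum>js\<in>?L (Suc i) k. prod_list (map a js)) =
      (\<Sum>(l, js)\<in>(SIGMA l:{0..k}. ?L i (k - l)). a l * prod_list (map a js))"
    by (subst sum.reindex_cong[of "\<lambda>(l, js). l # js"]) (auto simp: case_prod_beta)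
  also have "\<dots> = (\<Sum>l=0..k. \<Sum>js\<in>?L i (k - l). a l * prod_list (map a js))"
    by (rule sum.Sigma[symmetric]) (auto intro: finite_lists_sum)
  also have "\<dots> = (\<Sum>l=0..k. a l * fps_nth (Abs_fps a ^ i) (k - l))"
    by (simp add: Suc sum_distrib_left[symmetric])
  finally show ?case by (simp add: fps_mult_nth)
qed

lemma sum_bounded_lists_eq_fps_power:
  fixes a :: "nat \<Rightarrow> real"
  shows "(\<Sum>js\<in>{js. length js = i \<and> sum_list js = k \<and> (\<forall>j\<in>set js. j \<le> n)}. prod_list (map a js)) =
    fps_nth (Abs_fps (\<lambda>j. if j \<le> n then a j else 0) ^ i) k"
proof -
  let ?a = "\<lambda>j. if j \<le> n then a j else 0"
  have zero: "prod_list (map ?a js) = 0" if "\<not> (\<forall>j\<in>set js. j \<le> n)" for js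
    using that by (induction js) auto
  have eq: "prod_list (map ?a js) = prod_list (map a js)" if "\<forall>j\<in>set js. j \<le> n" for js
    using that by (induction js) auto
  have "(\<Sum>js\<in>{js. length js = i \<and> sum_list js = k \<and> (\<forall>j\<in>set js. j \<le> n)}. prod_list (map a js)) =
      (\<Sum>js\<in>{js. length js = i \<and> sum_list js = k}. prod_list (map ?a js))"
    by (rule sum.mono_neutral_cong_left[OF finite_lists_sum]) (auto simp: zero eq)
  then show ?thesis by (simp add: sum_lists_eq_fps_power)
qed

text \<open>The factor containing the coefficient of index \<open>Suc n\<close> can sit in any of the \<open>i\<close>
  positions, and then all other factors have index \<open>0\<close>.\<close>

lemma fps_power_nth_split_last:
  fixes a :: "nat \<Rightarrow> real" and n :: nat
  defines "A \<equiv> Abs_fps a" and "A' \<equiv> Abs_fps (\<lambda>j. if j \<le> n then a j else 0)"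
  shows "fps_nth (A ^ i) (Suc n) = fps_nth (A' ^ i) (Suc n) + real i * a 0 ^ (i - 1) * a (Suc n)"
proof (induction i)
  case (Suc i)
  have low: "fps_nth (A ^ i) l = fps_nth (A' ^ i) l" if "l \<le> n" for i l
    using that
  proof (induction i arbitrary: l)
    case (Suc i)
    then show ?case by (auto simp: fps_mult_nth A_def A'_def intro!: sum.cong)
  qed simp
  have "fps_nth (A ^ Suc i) (Suc n) = a 0 * fps_nth (A ^ i) (Suc n) +
      (\<Sum>l=1..n. a l * fps_nth (A ^ i) (Suc n - l)) + a (Suc n) * a 0 ^ i"
    by (simp add: fps_mult_nth A_def sum.atLeast_Suc_atMost[of 0] fps_power_zeroth)
  also have "(\<Sum>l=1..n. a l * fps_nth (A ^ i) (Suc n - l)) =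
      (\<Sum>l=1..n. a l * fps_nth (A' ^ i) (Suc n - l))"
    by (intro sum.cong refl arg_cong2[of _ _ _ _ "(*)"] low) auto
  also have "a 0 * fps_nth (A ^ i) (Suc n) =
      a 0 * fps_nth (A' ^ i) (Suc n) + real i * a 0 ^ i * a (Suc n)"
    unfolding Suc by (cases i) (simp_all add: algebra_simps)
  also have "a 0 * fps_nth (A' ^ i) (Suc n) + real i * a 0 ^ i * a (Suc n) +
      (\<Sum>l=1..n. a l * fps_nth (A' ^ i) (Suc n - l)) + a (Suc n) * a 0 ^ i =
      fps_nth (A' ^ Suc i) (Suc n) + real (Suc i) * a 0 ^ i * a (Suc n)"
    by (simp add: fps_mult_nth A'_def sum.atLeast_Suc_atMost[of 0] algebra_simps)
  finally show ?case by simp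
qed simp

text \<open>Nonnegative coefficients make the convergence absolute, so the Cauchy product applies at
  every step of the induction.\<close>

lemma fps_power_sums:
  fixes a :: "nat \<Rightarrow> real"
  assumes a: "\<And>k. 0 \<le> a k" "(\<lambda>k. a k * v ^ k) sums s" and v: "0 \<le> v"
  shows "0 \<le> fps_nth (Abs_fps a ^ i) k"
    and "(\<lambda>k. fps_nth (Abs_fps a ^ i) k * v ^ k) sums (s ^ i)"
proof -
  have nn: "0 \<le> fps_nth (Abs_fps a ^ i) k" for i k
    by (induction i arbitrary: k) (auto simp: fps_mult_nth intro!: sum_nonneg mult_nonneg_nonneg a)
  show "0 \<le> fps_nth (Abs_fps a ^ i) k" by (rule nn)
  show "(\<lambda>k. fps_nth (Abs_fps a ^ i) k * v ^ k) sums (s ^ i)"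
  proof (induction i)
    case 0
    have "(\<lambda>k. fps_nth (Abs_fps a ^ 0) k * v ^ k) = (\<lambda>k. if k = 0 then 1 else 0)" by
      (auto simp: fun_eq_iff)
    then show ?case using sums_single[of 0 "\<lambda>_. 1::real"] by simp
  next
    case (Suc i)
    have "(\<lambda>k. \<Sum>l\<le>k. (a l * v ^ l) * (fps_nth (Abs_fps a ^ i) (k - l) * v ^ (k - l))) sums
        ((\<Sum>k. a k * v ^ k) * (\<Sum>k. fps_nth (Abs_fps a ^ i) k * v ^ k))"
      using a v nn Suc by (intro Cauchy_product_sums) (auto simp: sums_iff abs_mult)
    moreover have "(\<Sum>l\<le>k. (a l * v ^ l) * (fps_nth (Abs_fps a ^ i) (k - l) * v ^ (k - l))) =
        fps_nth (Abs_fps a ^ Suc i) k * v ^ k" for k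
    proof -
      have eq: "(a l * v ^ l) * (fps_nth (Abs_fps a ^ i) (k - l) * v ^ (k - l)) =
          a l * fps_nth (Abs_fps a ^ i) (k - l) * v ^ k" if "l \<le> k" for l
        using that power_add[of v l "k - l"] by simp
      show ?thesis
        unfolding power_Suc fps_mult_nth sum_distrib_right atLeast0AtMost fps_nth_Abs_fps
        by (intro sum.cong refl eq) simp
    qed
    ultimately show ?case using a(2) Suc by (simp add: sums_iff)
  qed
qed

text \<open>Once the lower coefficients vanish, division by v^k leaves a series that is 0 on (0, 1)
  and tends to \<open>E k\<close> at 0 from the right.\<close>

lemma power_series_zero_coeff:
  fixes E :: "nat \<Rightarrow> real"
  assumes "\<And>v. 0 < v \<Longrightarrow> v < 1 \<Longrightarrow> (\<lambda>k. E k * v ^ k) sums 0"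
  shows "E k = 0"
proof (induction k rule: less_induct)
  case (less k)
  define f where "f x = (\<Sum>n. E (n + k) * x ^ n)" for x
  have zero: "(\<lambda>n. E (n + k) * v ^ n) sums 0" if v: "0 < v" "v < 1" for v
  proof -
    have "(\<lambda>n. E (n + k) * v ^ (n + k)) sums 0"
      using sums_split_initial_segment[OF assms[OF v], of k] less by simp
    then have "(\<lambda>n. (E (n + k) * v ^ n) * v ^ k) sums (0 * v ^ k)"
      by (simp add: power_add mult_ac)
    then show ?thesis by (subst (asm) sums_mult2_iff) (use v in auto)
  qed
  have "summable (\<lambda>n. E (n + k) * x ^ n)" if "norm x < 1/2" for x
    using powser_inside[of "\<lambda>n. E (n + k)" "1/2" x] zero[of "1/2"] that by (simp add: sums_iff)
  then have "(\<lambda>n. E (n + k) * x ^ n) sums f x" if "norm x < 1/2" for x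
    using that unfolding f_def by (blast intro: summable_sums)
  then have "(f \<longlongrightarrow> E (0 + k)) (at 0)"
    by (intro powser_limit_0[of "1/2" "\<lambda>n. E (n + k)" f]) simp_all
  then have "(f \<longlongrightarrow> E k) (at_right 0)"
    by (auto intro: filterlim_at_within_not_equal tendsto_within_subset)
  moreover have "\<forall>\<^sub>F x in at_right 0. f x = 0"
    using eventually_at_right_real[of 0 1]
    by (auto simp: f_def dest!: zero elim!: eventually_mono simp: sums_iff)
  ultimately have "((\<lambda>_. 0) \<longlongrightarrow> E k) (at_right (0::real))"
    by (auto intro: Lim_transform_eventually)
  then show ?case by (simp add: tendsto_const_iff)
qed

text \<open>Fubini for a double series: the absolute values sum to at most the sum of \<bar>\<beta>
  i\<bar>, because \<open>s i \<le> 1\<close>. Absolute values are needed since the coefficient at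
  index 1 will be negative.\<close>

lemma sums_swap_nonneg:
  fixes \<beta> :: "nat \<Rightarrow> real" and c :: "nat \<Rightarrow> nat \<Rightarrow> real"
  assumes \<beta>: "summable (\<lambda>i. \<bar>\<beta> i\<bar>)"
    and c: "\<And>i k. 0 \<le> c i k" "\<And>i. c i sums s i" "\<And>i. s i \<le> 1"
  shows "summable (\<lambda>i. \<beta> i * c i k)"
    and "(\<lambda>k. \<Sum>i. \<beta> i * c i k) sums (\<Sum>i. \<beta> i * s i)"
proof -
  have c1: "c i k \<le> 1" for i k
    using sum_le_suminf[of "c i" "{k}"] c[of i] order_trans by (fastforce simp: sums_iff)
  have s0: "0 \<le> s i" for i using c sums_le[of "\<lambda>_. 0" "c i" 0 "s i"] by (simp add: sums_0)
  have sm: "summable (\<lambda>i. \<beta> i * c i k)" for k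
    by (rule summable_comparison_test'[OF \<beta>, of 0]) (auto simp: abs_mult c c1 mult_left_le)
  then show "summable (\<lambda>i. \<beta> i * c i k)" .
  have hs: "((\<lambda>k. \<bar>\<beta> i\<bar> * c i k) has_sum \<bar>\<beta> i\<bar> * s i) UNIV" for i
    using c by (intro sums_nonneg_imp_has_sum sums_mult) auto
  have "summable (\<lambda>i. \<bar>\<beta> i\<bar> * s i)"
    by (rule summable_comparison_test'[OF \<beta>, of 0]) (auto simp: abs_mult c s0 mult_left_le)
  then have "(\<lambda>i. \<bar>\<beta> i\<bar> * s i) summable_on UNIV"
    by (rule summable_nonneg_imp_summable_on) (simp add: s0)
  then have "(\<lambda>(i, k). \<bar>\<beta> i\<bar> * c i k) summable_on UNIV \<times> UNIV"
    by (intro summable_on_SigmaI[where g = "\<lambda>i. \<bar>\<beta> i\<bar> * s i"]) (use hs c in auto)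
  then have so: "(\<lambda>(i, k). \<beta> i * c i k) summable_on UNIV \<times> UNIV"
    by (subst summable_on_iff_abs_summable_on_real) (simp add: case_prod_unfold abs_mult c)
  have h1: "((\<lambda>k. \<beta> i * c i k) has_sum \<beta> i * s i) UNIV" for i
    using c by (intro has_sum_cmult_right sums_nonneg_imp_has_sum) auto
  have h2: "((\<lambda>i. \<beta> i * c i k) has_sum (\<Sum>i. \<beta> i * c i k)) UNIV" for k
    by (intro norm_summable_imp_has_sum summable_sums sm summable_comparison_test'[OF \<beta>, of 0])
      (auto simp: abs_mult c c1 mult_left_le)
  obtain S where S: "((\<lambda>(i, k). \<beta> i * c i k) has_sum S) (UNIV \<times> UNIV)"
    using so by (auto simp: summable_on_def)
  then have S': "((\<lambda>(k, i). \<beta> i * c i k) has_sum S) (UNIV \<times> UNIV)"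
    by (subst has_sum_swap) simp
  have "(\<lambda>i. \<beta> i * s i) sums S"
    by (rule has_sum_imp_sums, rule has_sum_SigmaD[OF S]) (use h1 in auto)
  moreover have "(\<lambda>k. \<Sum>i. \<beta> i * c i k) sums S"
    by (rule has_sum_imp_sums, rule has_sum_SigmaD[OF S']) (use h2 in auto)
  ultimately show "(\<lambda>k. \<Sum>i. \<beta> i * c i k) sums (\<Sum>i. \<beta> i * s i)" by (simp add: sums_iff)
qed

section \<open>The derivative of B_m and the uniqueness of the recursion\<close>

lemma Bm_fun_alt: "Bm_fun b m u = (\<Sum>j. (if j = m then 0 else b j) * u ^ j)"
  unfolding Bm_fun_def by (intro arg_cong[where f = suminf] ext) simp

lemma Bm_fun_deriv:
  assumes b: "summable (\<lambda>j. \<bar>b j\<bar>)" and u: "\<bar>u\<bar> < 1"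
  shows "(Bm_fun b m has_real_derivative deriv (Bm_fun b m) u) (at u)"
    and "(\<lambda>i. real i * (if i = m then 0 else b i) * u ^ (i - 1)) sums deriv (Bm_fun b m) u"
proof -
  define \<beta> where "\<beta> j = (if j = m then 0 else b j)" for j
  have \<beta>: "summable \<beta>"
    by (rule summable_comparison_test'[OF b, of 0]) (simp add: \<beta>_def)
  have Bm: "Bm_fun b m = (\<lambda>u. \<Sum>j. \<beta> j * u ^ j)" by (simp add: fun_eq_iff Bm_fun_alt \<beta>_def)
  have D: "(Bm_fun b m has_real_derivative (\<Sum>n. diffs \<beta> n * u ^ n)) (at u)"
    unfolding Bm by (rule termdiffs_strong[of \<beta> 1]) (use \<beta> u in auto)
  then have d: "deriv (Bm_fun b m) u = (\<Sum>n. diffs \<beta> n * u ^ n)" by (rule DERIV_imp_deriv)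
  show "(Bm_fun b m has_real_derivative deriv (Bm_fun b m) u) (at u)" using D d by simp
  have "summable (\<lambda>n. diffs \<beta> n * u ^ n)"
  proof (rule termdiff_converges[of u 1])
    fix x :: real assume "norm x < 1"
    then show "summable (\<lambda>n. \<beta> n * x ^ n)" using powser_inside[of \<beta> 1 x] \<beta> by simp
  qed (use u in simp)
  then have "(\<lambda>n. real (Suc n) * \<beta> (Suc n) * u ^ (Suc n - 1)) sums deriv (Bm_fun b m) u"
    unfolding d by (simp add: diffs_def summable_sums)
  \<comment> \<open>The added term at \<open>i = 0\<close> is 0 because of the factor
    \<open>real i\<close>, whatever the truncated exponent \<open>i - 1\<close> is.\<close>
  then show "(\<lambda>i. real i * (if i = m then 0 else b i) * u ^ (i - 1)) sums deriv (Bm_fun b m) u"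
    using sums_Suc_iff[of "\<lambda>i. real i * \<beta> i * u ^ (i - 1)"] by (simp add: \<beta>_def)
qed

text \<open>The recursion equates the coefficients in \<open>B\<^sub>m(F(v)) + v b\<^sub>m F(v)\<^sup>m = 0\<close>.\<close>

lemma rho_seq_eqI:
  fixes a b :: "nat \<Rightarrow> real" and F :: "real \<Rightarrow> real"
  assumes b: "summable (\<lambda>j. \<bar>b j\<bar>)" and m: "1 < m"
    and a: "\<And>k. 0 \<le> a k" "\<And>v. 0 < v \<Longrightarrow> v < 1 \<Longrightarrow> (\<lambda>k. a k * v ^ k) sums F v"
    and F: "\<And>v. 0 < v \<Longrightarrow> v < 1 \<Longrightarrow> F v \<le> 1"
    and eq: "\<And>v. 0 < v \<Longrightarrow> v < 1 \<Longrightarrow> Bm_fun b m (F v) + v * b m * F v ^ m = 0"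
    and a0: "a 0 = min_nonneg_root (Bm_fun b m)" "a 0 < 1"
    and deriv: "deriv (Bm_fun b m) (a 0) \<noteq> 0"
  shows "rho_seq b m k = a k"
proof -
  define \<beta> where "\<beta> i = (if i = m then 0 else b i)" for i
  define c where "c i k = fps_nth (Abs_fps a ^ i) k" for i k
  define D where "D k = (\<Sum>i. \<beta> i * c i k)" for k
  \<comment> \<open>The coefficient of v^k in B_m(F(v)) + v b_m F(v)^m. The factor v shifts the
    second summand by one, so it contributes nothing at \<open>k = 0\<close>.\<close>
  define E where "E k = D k + (if k = 0 then 0 else b m * c m (k - 1))" for k
  let ?d = "deriv (Bm_fun b m) (a 0)"
  have \<beta>: "summable (\<lambda>i. \<bar>\<beta> i\<bar>)"
    by (rule summable_comparison_test'[OF b, of 0]) (simp add: \<beta>_def)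
  have F0: "0 \<le> F v" if "0 < v" "v < 1" for v
    using a(2)[OF that] a(1) that sums_le[of "\<lambda>_. 0" "\<lambda>k. a k * v ^ k" 0 "F v"] by simp
  have c_nn: "0 \<le> c i k" for i k
    unfolding c_def using fps_power_sums(1)[OF a(1) a(2)[of "1/2"]] by simp
  have c_sums: "(\<lambda>k. c i k * v ^ k) sums (F v ^ i)" if "0 < v" "v < 1" for v i
    unfolding c_def using fps_power_sums(2)[OF a(1) a(2)[OF that]] that by simp
  have swap: "summable (\<lambda>i. \<beta> i * (c i k * v ^ k))"
    "(\<lambda>k. \<Sum>i. \<beta> i * (c i k * v ^ k)) sums (\<Sum>i. \<beta> i * F v ^ i)" if v: "0 < v" "v < 1" for v k
    using sums_swap_nonneg[OF \<beta> _ c_sums[OF v]] c_nn F[OF v] F0[OF v] v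
    by (simp_all add: power_le_one)
  have D_sm: "summable (\<lambda>i. \<beta> i * c i k)" for k
    using summable_mult2[OF swap(1)[of "1/2" k], of "2 ^ k"]
    by (simp add: power_one_over field_simps)
  have "(\<lambda>k. E k * v ^ k) sums 0" if v: "0 < v" "v < 1" for v
  proof -
    have "(\<lambda>k. D k * v ^ k) sums Bm_fun b m (F v)"
      using swap(2)[OF v] suminf_mult2[OF D_sm, of _ "v ^ _"]
      by (simp add: D_def Bm_fun_alt \<beta>_def mult.assoc)
    moreover have "(\<lambda>k. (v * b m) * (c m k * v ^ k)) sums ((v * b m) * F v ^ m)"
      by (intro sums_mult c_sums v)
    then have "(\<lambda>k. (if k = 0 then 0 else b m * c m (k - 1)) * v ^ k) sums (v * b m * F v ^ m)"
      by - (rule sums_Suc_imp, simp, simp add: mult_ac)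
    ultimately have "(\<lambda>k. E k * v ^ k) sums (Bm_fun b m (F v) + v * b m * F v ^ m)"
      unfolding E_def distrib_right by (rule sums_add)
    then show ?thesis using eq[OF v] by simp
  qed
  then have E0: "E k = 0" for k by (rule power_series_zero_coeff)
  have a0_nn: "0 \<le> a 0" by (rule a)
  \<comment> \<open>\<open>a (Suc n)\<close> occurs linearly in the coefficient of index
    \<open>Suc n\<close> of each power, and its total factor is the sum of i \<beta>_i a_0^(i-1),
    the derivative of B_m at a_0. Everything else involves smaller indices only.\<close>
  have rec: "a (Suc n) =
      - ((\<Sum>i. \<beta> i * fps_nth (Abs_fps (\<lambda>j.
    if j \<le> n then a j else 0) ^ i) (Suc n)) + b m * c m n) / ?d" for n
  proof -
    define T where "T i = fps_nth (Abs_fps (\<lambda>j. if j \<le> n then a j else 0) ^ i) (Suc n)" for i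
    have split: "c i (Suc n) = T i + real i * a 0 ^ (i - 1) * a (Suc n)" for i
      unfolding c_def T_def by (rule fps_power_nth_split_last)
    have "(\<lambda>i. real i * \<beta> i * a 0 ^ (i - 1)) sums ?d"
      unfolding \<beta>_def by (rule Bm_fun_deriv(2)[OF b]) (use a0 a0_nn in simp)
    then have "(\<lambda>i. real i * \<beta> i * a 0 ^ (i - 1) * a (Suc n)) sums (?d * a (Suc n))"
      by (rule sums_mult2)
    moreover have "(\<lambda>i. \<beta> i * c i (Suc n)) sums D (Suc n)" unfolding D_def using D_sm
      by (rule summable_sums)
    ultimately have "(\<lambda>i. \<beta> i * c i (Suc n) - real i * \<beta> i * a 0 ^ (i - 1) * a (Suc n)) sums
        (D (Suc n) - ?d * a (Suc n))"
      by (intro sums_diff)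
    then have "(\<lambda>i. \<beta> i * T i) sums (D (Suc n) - ?d * a (Suc n))"
      by (simp add: split algebra_simps)
    moreover have "D (Suc n) + b m * c m n = 0" using E0[of "Suc n"] by (simp add: E_def)
    ultimately have "(\<Sum>i. \<beta> i * T i) + b m * c m n = - (?d * a (Suc n))" by (simp add: sums_iff)
    then show ?thesis using deriv by (simp add: T_def field_simps)
  qed
  show ?thesis
  proof (induction k rule: less_induct)
    case (less k)
    consider "k = 0" | "k = Suc 0" | n where "k = Suc (Suc n)" by (metis not0_implies_Suc)
    then show ?case
    proof cases
      case 1 then show ?thesis by (simp add: a0)
    next
      case 2
      \<comment> \<open>For index 1 only entries 0 are allowed, and no such tuple has sum 1; so just
        the term with b_m is left.\<close>
      have "fps_nth (Abs_fps (\<lambda>j. if j \<le> 0 then a j else 0) ^ i) (Suc 0) = 0" for i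
      proof -
        have "sum_list js = 0" if "\<forall>j\<in>set js. j \<le> (0::nat)" for js
          using that by (induction js) auto
        then have "\<not> (length js = i \<and> sum_list js = Suc 0 \<and> (\<forall>j\<in>set js. j \<le> 0))" for js
          by (metis Zero_not_Suc)
        then have "{js. length js = i \<and> sum_list js = Suc 0 \<and> (\<forall>j\<in>set js. j \<le> 0)} = {}"
          unfolding Collect_empty_eq by (rule allI)
        then show ?thesis unfolding sum_bounded_lists_eq_fps_power[symmetric]
          by (simp only: sum.empty)
      qed
      moreover have "c m 0 = a 0 ^ m" by (simp add: c_def fps_power_zeroth)
      ultimately have "a (Suc 0) = - (b m * a 0 ^ m) / ?d"
        by (subst rec[of 0]) (simp only: mult_zero_right suminf_zero add_0)
      then show ?thesis unfolding 2 rho_seq.simps(1,2) a0(1)[symmetric] by (rule sym)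
    next
      case (3 n)
      have IH: "prod_list (map (rho_seq b m) js) = prod_list (map a js)" if "\<forall>j\<in>set js. j \<le> Suc n"
        for js
      proof (intro arg_cong[where f = prod_list] map_cong refl less)
        fix j assume "j \<in> set js"
        then have "j \<le> Suc n" using that by blast
        then show "j < k" using 3 by simp
      qed
      have 1: "(if i = 1 \<or> i = m then 0 else b i * (\<Sum>js\<in>{js. length js = i \<and> sum_list js =
          Suc (Suc n) \<and>
                                  (\<forall>j\<in>set js. j \<le> Suc n)}. prod_list (map (rho_seq b m) js)))
        = \<beta> i * fps_nth (Abs_fps (\<lambda>j. if j \<le> Suc n then a j else 0) ^ i) (Suc (Suc n))" for i
      \<comment> \<open>The recursion leaves out \<open>i = 1\<close>, whereas
        \<open>\<beta>\<close> does not; the terms agree because a series cut off at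
        \<open>Suc n\<close> has coefficient 0 at \<open>Suc (Suc n)\<close>.\<close>
      proof (cases "i = 1")
        case True
        then show ?thesis by simp
      next
        case False
        have "(\<Sum>js\<in>{js. length js = i \<and> sum_list js = Suc (Suc n) \<and>
            (\<forall>j\<in>set js. j \<le> Suc n)}. prod_list (map (rho_seq b m) js)) =
          (\<Sum>js\<in>{js. length js = i \<and> sum_list js = Suc (Suc n) \<and> (\<forall>j\<in>set js. j \<le> Suc n)}. prod_list (map a js))"
          by (intro sum.cong refl IH) blast
        then show ?thesis
          using False by (simp add: \<beta>_def sum_bounded_lists_eq_fps_power del: One_nat_def)
      qed
      have 2: "(\<Sum>js\<in>{js. length js = m \<and> sum_list js = Suc n}. prod_list (map (rho_seq b m) js)) =
          c m (Suc n)"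
        unfolding c_def sum_lists_eq_fps_power[symmetric]
      proof (intro sum.cong refl IH ballI)
        fix js j assume "js \<in> {js. length js = m \<and> sum_list js = Suc n}" "j \<in> set js"
        then show "j \<le> Suc n" using member_le_sum_list[of j js] by simp
      qed
      show ?thesis
        unfolding 3 rho_seq.simps(3) 1 2 rec[of "Suc n"] rho_seq.simps(1) a0(1)[symmetric]
        by (rule refl)
    qed
  qed
qed

text \<open>The M-test gives uniform convergence up to and including the endpoint 1, where the limit
  from the left will be taken.\<close>

lemma power_series_continuous_on_unit:
  fixes c :: "nat \<Rightarrow> real"
  assumes "summable (\<lambda>k. \<bar>c k\<bar>)"
  shows "continuous_on {0..1} (\<lambda>u. \<Sum>k. c k * u ^ k)"
proof (rule uniform_limit_theorem)
  show "uniform_limit {0..1} (\<lambda>n u. \<Sum>k<n. c k * u ^ k) (\<lambda>u. \<Sum>k. c k * u ^ k) sequentially"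
    by (rule Weierstrass_m_test[OF _ assms])
    (auto simp: abs_mult power_abs power_le_one mult_left_le)
qed (auto intro!: always_eventually continuous_intros)

lemma integral_uniform_measure:
  fixes f :: "'a \<Rightarrow> real"
  assumes f: "f \<in> borel_measurable M" and A: "A \<in> sets M" "emeasure M A \<noteq> \<infinity>" "0 < measure M A"
  shows "(\<integral>x. f x \<partial>uniform_measure M A) = (\<integral>x. f x * indicator A x \<partial>M) / measure M A"
proof -
  have "indicator A x / emeasure M A = ennreal (indicator A x / measure M A)" for x
    using A by (simp add: emeasure_eq_ennreal_measure divide_ennreal[symmetric] ennreal_indicator)
  then have "(\<integral>x. f x \<partial>uniform_measure M A) = (\<integral>x. (indicator A x / measure M A) *\<^sub>R f x \<partial>M)"
    unfolding uniform_measure_def using f A by (simp only:, subst integral_density) auto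
  then show ?thesis by (simp add: mult.commute)
qed

subsection \<open>The Markov chain observed on a grid\<close>

text \<open>A functional of finitely many coordinates that vanishes outside {..N} is a finite
  combination of cylinder indicators. The elementary Markov property speaks about exactly these
  cylinders.\<close>

lemma path_functional_expand:
  fixes \<Phi> :: "(nat \<Rightarrow> nat) \<Rightarrow> real"
  assumes dep: "\<forall>x y. (\<forall>k\<le>n. x k = y k) \<longrightarrow> \<Phi> x = \<Phi> y"
    and supp: "\<forall>x k. \<Phi> x \<noteq> 0 \<longrightarrow> k \<le> n \<longrightarrow> x k \<le> N"
  shows "\<Phi> x = (\<Sum>\<pi>\<in>PiE {..n} (\<lambda>_. {..N}). if \<forall>k\<le>n. x k = \<pi> k then \<Phi> \<pi> else 0)"
proof (cases "\<forall>k\<le>n. x k \<le> N")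
  case True
  let ?\<pi> = "restrict x {..n}"
  have mem: "?\<pi> \<in> PiE {..n} (\<lambda>_. {..N})" using True by auto
  have "(\<forall>k\<le>n. x k = \<pi> k) \<longleftrightarrow> \<pi> = ?\<pi>" if "\<pi> \<in> PiE {..n} (\<lambda>_. {..N})" for \<pi>
  proof
    assume "\<forall>k\<le>n. x k = \<pi> k"
    then show "\<pi> = ?\<pi>" using that by (intro PiE_ext[OF that mem]) auto
  qed auto
  then have "(\<Sum>\<pi>\<in>PiE {..n} (\<lambda>_. {..N}). if \<forall>k\<le>n. x k = \<pi> k then \<Phi> \<pi> else 0)
      = (\<Sum>\<pi>\<in>PiE {..n} (\<lambda>_. {..N}). if \<pi> = ?\<pi> then \<Phi> \<pi> else 0)"
    by (intro sum.cong) simp_all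
  also have "\<dots> = \<Phi> ?\<pi>" using mem by (subst sum.delta) (auto intro!: finite_PiE)
  also have "\<dots> = \<Phi> x" using dep by simp
  finally show ?thesis by simp
next
  case False
  then have "\<Phi> x = 0" using supp by blast
  moreover have "\<not> (\<forall>k\<le>n. x k = \<pi> k)" if "\<pi> \<in> PiE {..n} (\<lambda>_. {..N})" for \<pi>
  proof -
    obtain k where k: "k \<le> n" "\<not> x k \<le> N" using False by blast
    have "\<pi> k \<le> N" using PiE_mem[OF that, of k] k by simp
    then show ?thesis using k by metis
  qed
  then have "(\<Sum>\<pi>\<in>PiE {..n} (\<lambda>_. {..N}). if \<forall>k\<le>n. x k = \<pi> k then \<Phi> \<pi> else 0) = 0"
    by (intro sum.neutral ballI) (simp add: if_not_P)
  ultimately show ?thesis by simp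
qed

locale branching_chain = prob_space M for M :: "'a measure" +
  fixes X :: "real \<Rightarrow> 'a \<Rightarrow> nat" and p :: "real \<Rightarrow> nat \<Rightarrow> nat \<Rightarrow> real"
    and b w :: "nat \<Rightarrow> real" and m :: nat
  assumes X_measurable: "0 \<le> t \<Longrightarrow> X t \<in> measurable M (count_space UNIV)"
    and X_regular: "\<omega> \<in> space M \<Longrightarrow> regular_path (\<lambda>t. X t \<omega>)"
    and p_transition: "transition_function p"
    and p_Q: "has_Q_matrix p (branching_Q b w)"
    and X_markov: "markov_property M X p"
    and rates: "branching_rates b w"
    and X_0: "AE \<omega> in M. X 0 \<omega> = 1"
    and m_gt_1: "1 < m"
begin

lemma X_event: "0 \<le> t \<Longrightarrow> {\<omega> \<in> space M. P (X t \<omega>)} \<in> events"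
  using measurable_sets[OF X_measurable, of t "{i. P i}"]
  by (simp add: vimage_def Int_def conj_commute)

lemma path_event: "0 \<le> h \<Longrightarrow> {\<omega> \<in> space M. \<forall>k\<le>n. X (real k * h) \<omega> = i k} \<in> events"
  by (intro sets.sets_Collect_countable_All sets.sets_Collect_imp X_event sets.sets_Collect_const) simp

text \<open>The identities for single cylinders are added up: the indicator of state
  \<open>j\<close> one step later may be replaced by a transition probability. The truncation at
  \<open>N\<close> keeps the sum finite, so linearity of the integral suffices.\<close>

lemma markov_step:
  fixes \<Phi> :: "(nat \<Rightarrow> nat) \<Rightarrow> real"
  assumes h: "0 < h"
    and dep: "\<forall>x y. (\<forall>k\<le>n. x k = y k) \<longrightarrow> \<Phi> x = \<Phi> y"
    and supp: "\<forall>x k. \<Phi> x \<noteq> 0 \<longrightarrow> k \<le> n \<longrightarrow> x k \<le> N"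
  defines "\<xi> \<equiv> \<lambda>\<omega> k. X (real k * h) \<omega>"
  shows "integrable M (\<lambda>\<omega>. \<Phi> (\<xi> \<omega>))"
    and "integrable M (\<lambda>\<omega>. \<Phi> (\<xi> \<omega>) * of_bool (\<xi> \<omega> (Suc n) = j))"
    and "(\<integral>\<omega>. \<Phi> (\<xi> \<omega>) * of_bool (\<xi> \<omega> (Suc n) = j) \<partial>M) = (\<integral>\<omega>. \<Phi> (\<xi> \<omega>) * p h (\<xi> \<omega> n) j \<partial>M)"
proof -
  let ?P = "PiE {..n} (\<lambda>_. {..N})"
  define A where "A \<pi> = {\<omega> \<in> space M. \<forall>k\<le>n. X (real k * h) \<omega> = \<pi> k}" for \<pi>
  define A' where "A' \<pi> = {\<omega> \<in> space M. \<forall>k\<le>Suc n. X (real k * h) \<omega> = (\<pi>(Suc n := j)) k}" for \<pi>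
  have A: "A \<pi> \<in> events" "A' \<pi> \<in> events" for \<pi>
    unfolding A_def A'_def using h by (simp_all only: path_event less_imp_le)
  have A': "\<omega> \<in> A' \<pi> \<longleftrightarrow> \<omega> \<in> A \<pi> \<and> \<xi> \<omega> (Suc n) = j" for \<omega> \<pi>
    unfolding A_def A'_def \<xi>_def by (auto simp: le_Suc_eq)
  have 1: "\<Phi> (\<xi> \<omega>) = (\<Sum>\<pi>\<in>?P. \<Phi> \<pi> * indicator (A \<pi>) \<omega>)" if "\<omega> \<in> space M" for \<omega>
    using that by (subst path_functional_expand[of n \<Phi> N, OF dep supp])
      (auto simp: A_def \<xi>_def intro!: sum.cong)
  have 2: "\<Phi> (\<xi> \<omega>) * of_bool (\<xi> \<omega> (Suc n) = j) = (\<Sum>\<pi>\<in>?P. \<Phi> \<pi> * indicator (A' \<pi>) \<omega>)"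
    if "\<omega> \<in> space M" for \<omega>
    using that by (simp add: 1 sum_distrib_right mult.assoc indicator_def A' flip: of_bool_conj)
  have 3: "\<Phi> (\<xi> \<omega>) * p h (\<xi> \<omega> n) j = (\<Sum>\<pi>\<in>?P. \<Phi> \<pi> * p h (\<pi> n) j * indicator (A \<pi>) \<omega>)"
    if "\<omega> \<in> space M" for \<omega>
    using that unfolding 1[OF that] sum_distrib_right
    by (intro sum.cong) (auto simp: A_def \<xi>_def indicator_def)
  have I: "integrable M (\<lambda>\<omega>. c * indicator (A \<pi>) \<omega>)" "integrable M (\<lambda>\<omega>. c * indicator (A' \<pi>) \<omega>)"
    for \<pi> and c :: real
    by (intro integrable_mult_right integrable_real_indicator A; simp add: emeasure_eq_measure)+
  show "integrable M (\<lambda>\<omega>. \<Phi> (\<xi> \<omega>))"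
    by (subst Bochner_Integration.integrable_cong[OF refl 1])
    (auto intro!: Bochner_Integration.integrable_sum I)
  show "integrable M (\<lambda>\<omega>. \<Phi> (\<xi> \<omega>) * of_bool (\<xi> \<omega> (Suc n) = j))"
    by (subst Bochner_Integration.integrable_cong[OF refl 2])
    (auto intro!: Bochner_Integration.integrable_sum I)
  have prob: "prob (A' \<pi>) = prob (A \<pi>) * p h (\<pi> n) j" for \<pi>
  proof -
    have "prob (A' \<pi>) = prob {\<omega> \<in> space M. \<forall>k\<le>n. X (real k * h) \<omega> = (\<pi>(Suc n := j)) k} *
        p (real (Suc n) * h - real n * h) ((\<pi>(Suc n := j)) n) ((\<pi>(Suc n := j)) (Suc n))"
      unfolding A'_def
      by (rule X_markov[unfolded markov_property_def, rule_format]) (use h in auto)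
    also have "real (Suc n) * h - real n * h = h" by (simp add: algebra_simps)
    also have "{\<omega> \<in> space M. \<forall>k\<le>n. X (real k * h) \<omega> = (\<pi>(Suc n := j)) k} = A \<pi>"
      by (auto simp: A_def)
    finally show ?thesis by simp
  qed
  have "(\<integral>\<omega>. \<Phi> (\<xi> \<omega>) * of_bool (\<xi> \<omega> (Suc n) = j) \<partial>M) = (\<Sum>\<pi>\<in>?P. \<Phi> \<pi> * prob (A' \<pi>))"
    by (subst Bochner_Integration.integral_cong[OF refl 2], assumption,
        subst Bochner_Integration.integral_sum[OF I(2)]) (simp add: Int_absorb2 sets.sets_into_space A)
  also have "\<dots> = (\<Sum>\<pi>\<in>?P. \<Phi> \<pi> * p h (\<pi> n) j * prob (A \<pi>))"
    by (simp add: prob mult_ac)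
  also have "\<dots> = (\<integral>\<omega>. \<Phi> (\<xi> \<omega>) * p h (\<xi> \<omega> n) j \<partial>M)"
    by (subst Bochner_Integration.integral_cong[OF refl 3], assumption,
        subst Bochner_Integration.integral_sum[OF I(1)]) (simp add: Int_absorb2 sets.sets_into_space A)
  finally show "(\<integral>\<omega>. \<Phi> (\<xi> \<omega>) * of_bool (\<xi> \<omega> (Suc n) = j) \<partial>M) = (\<integral>\<omega>. \<Phi> (\<xi> \<omega>) * p h (\<xi> \<omega> n) j \<partial>M)" .
qed

text \<open>The value 0 outside {0..N} is the killing. The test \<open>j + 1 = i + m\<close>
  expresses a jump of size m - 1 without subtraction on the naturals.\<close>

definition step_weight :: "real \<Rightarrow> nat \<Rightarrow> nat \<Rightarrow> nat \<Rightarrow> real" where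
  "step_weight v N i j = (if i \<le> N \<and> j \<le> N then if j + 1 = i + m then v else 1 else 0)"

definition weighted_step :: "real \<Rightarrow> nat \<Rightarrow> real \<Rightarrow> (nat \<Rightarrow> real) \<Rightarrow> nat \<Rightarrow> real" where
  "weighted_step v N h \<phi> i = (\<Sum>j\<le>N. p h i j * step_weight v N i j * \<phi> j)"

text \<open>A discrete Feynman-Kac functional. The final truncation is explicit because for
  \<open>n = 0\<close> there is no step factor to enforce it.\<close>

definition path_weight :: "real \<Rightarrow> nat \<Rightarrow> nat \<Rightarrow> (nat \<Rightarrow> real) \<Rightarrow> (nat \<Rightarrow> nat) \<Rightarrow> real" where
  "path_weight v N n \<phi> x =
      (\<Prod>k<n. step_weight v N (x k) (x (Suc k))) * (if x n \<le> N then \<phi> (x n) else 0)"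

definition skeleton :: "real \<Rightarrow> nat \<Rightarrow> real \<Rightarrow> nat \<Rightarrow> (nat \<Rightarrow> real) \<Rightarrow> real" where
  "skeleton v N h n \<phi> = (\<integral>\<omega>. path_weight v N n \<phi> (\<lambda>k. X (real k * h) \<omega>) \<partial>M)"

section \<open>Monotonicity, linearity and one-step recursion of the weighted skeleton\<close>

lemma path_weight_cong:
  "\<forall>x y. (\<forall>k\<le>n. x k = y k) \<longrightarrow> path_weight v N n \<phi> x = path_weight v N n \<phi> y"
  by (simp add: path_weight_def)

lemma path_weight_support:
  "\<forall>x k. path_weight v N n \<phi> x \<noteq> 0 \<longrightarrow> k \<le> n \<longrightarrow> x k \<le> N"
proof (intro allI impI)
  fix x k assume nz: "path_weight v N n \<phi> x \<noteq> 0" and "k \<le> n"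
  show "x k \<le> N"
  proof (cases "k = n")
    case False
    then have "step_weight v N (x k) (x (Suc k)) \<noteq> 0"
      using nz \<open>k \<le> n\<close> by (auto simp: path_weight_def)
    then show ?thesis by (auto simp: step_weight_def split: if_splits)
  qed (use nz in \<open>auto simp: path_weight_def split: if_splits\<close>)
qed

lemma integrable_path_weight:
  "0 < h \<Longrightarrow> integrable M (\<lambda>\<omega>. path_weight v N n \<phi> (\<lambda>k. X (real k * h) \<omega>))"
  by (rule markov_step(1)[OF _ path_weight_cong path_weight_support])

lemma path_weight_mono:
  "0 \<le> v \<Longrightarrow> (\<And>i. i \<le> N \<Longrightarrow> \<phi> i \<le> \<psi> i) \<Longrightarrow> path_weight v N n \<phi> x \<le> path_weight v N n \<psi> x"
  unfolding path_weight_def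
  by (intro mult_left_mono prod_nonneg) (auto simp: step_weight_def)

lemma skeleton_mono:
  assumes "0 < h" "0 \<le> v" "\<And>i. i \<le> N \<Longrightarrow> \<phi> i \<le> \<psi> i"
  shows "skeleton v N h n \<phi> \<le> skeleton v N h n \<psi>"
  unfolding skeleton_def using assms
  by (intro integral_mono integrable_path_weight path_weight_mono)

lemma skeleton_scale: "skeleton v N h n (\<lambda>i. c * \<phi> i) = c * skeleton v N h n \<phi>"
proof -
  have "path_weight v N n (\<lambda>i. c * \<phi> i) x = c * path_weight v N n \<phi> x" for x
    by (simp add: path_weight_def)
  then show ?thesis by (simp add: skeleton_def)
qed

lemma skeleton_add:
  assumes "0 < h"
  shows "skeleton v N h n (\<lambda>i. \<phi> i + \<psi> i) = skeleton v N h n \<phi> + skeleton v N h n \<psi>"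
proof -
  have "path_weight v N n (\<lambda>i. \<phi> i + \<psi> i) x = path_weight v N n \<phi> x + path_weight v N n \<psi> x" for x
    by (simp add: path_weight_def distrib_left)
  then show ?thesis using assms by (simp add: skeleton_def integrable_path_weight)
qed

lemma skeleton_0: "1 \<le> N \<Longrightarrow> skeleton v N h 0 \<phi> = \<phi> 1"
proof -
  assume N: "1 \<le> N"
  have "skeleton v N h 0 \<phi> = (\<integral>\<omega>. \<phi> 1 \<partial>M)"
    unfolding skeleton_def
  proof (rule integral_cong_AE)
    show "(\<lambda>\<omega>. path_weight v N 0 \<phi> (\<lambda>k. X (real k * h) \<omega>)) \<in> borel_measurable M"
      using measurable_compose[OF X_measurable[of 0], of "\<lambda>i. if i \<le> N then \<phi> i else 0" borel]
      by (simp add: path_weight_def cong: if_cong)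
    show "AE \<omega> in M. path_weight v N 0 \<phi> (\<lambda>k. X (real k * h) \<omega>) = \<phi> 1"
      using X_0 by eventually_elim (use N in \<open>simp add: path_weight_def\<close>)
  qed simp
  then show ?thesis by (simp add: prob_space)
qed

text \<open>The last step is peeled off, so the operator acts on the terminal function while the
  starting state stays fixed. Iteration yields powers of the weighted one-step matrix.\<close>

lemma skeleton_Suc:
  assumes h: "0 < h"
  shows "skeleton v N h (Suc n) \<phi> = skeleton v N h n (weighted_step v N h \<phi>)"
proof -
  define \<Phi> where "\<Phi> j x = path_weight v N n (\<lambda>i. step_weight v N i j * \<phi> j) x" for j x
  have dep: "\<forall>x y. (\<forall>k\<le>n. x k = y k) \<longrightarrow> \<Phi> j x = \<Phi> j y" for j
    unfolding \<Phi>_def by (rule path_weight_cong)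
  have supp: "\<forall>x k. \<Phi> j x \<noteq> 0 \<longrightarrow> k \<le> n \<longrightarrow> x k \<le> N" for j
    unfolding \<Phi>_def by (rule path_weight_support)
  have 1: "path_weight v N (Suc n) \<phi> x = (\<Sum>j\<le>N. \<Phi> j x * of_bool (x (Suc n) = j))" for x
  proof -
    have "(\<Sum>j\<le>N. \<Phi> j x * of_bool (x (Suc n) = j)) = (\<Sum>j\<le>N. if x (Suc n) = j then \<Phi> j x else 0)"
      by (intro sum.cong) auto
    also have "\<dots> = (if x (Suc n) \<le> N then \<Phi> (x (Suc n)) x else 0)"
      by (subst sum.delta') auto
    also have "\<dots> = path_weight v N (Suc n) \<phi> x"
      by (auto simp: \<Phi>_def path_weight_def step_weight_def)
    finally show ?thesis by simp
  qed
  have 2: "(\<Sum>j\<le>N. \<Phi> j x * p h (x n) j) = path_weight v N n (weighted_step v N h \<phi>) x" for x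
    by (auto simp: \<Phi>_def path_weight_def weighted_step_def sum_distrib_left sum_distrib_right mult_ac intro!: sum.cong)
  have int: "integrable M (\<lambda>\<omega>. \<Phi> j (\<lambda>k. X (real k * h) \<omega>) * p h (X (real n * h) \<omega>) j)" for j
  proof (rule markov_step(1)[OF h, of n "\<lambda>x. \<Phi> j x * p h (x n) j" N])
    show "\<forall>x y. (\<forall>k\<le>n. x k = y k) \<longrightarrow> \<Phi> j x * p h (x n) j = \<Phi> j y * p h (y n) j"
      using dep[of j] by (metis order_refl)
    show "\<forall>x k. \<Phi> j x * p h (x n) j \<noteq> 0 \<longrightarrow> k \<le> n \<longrightarrow> x k \<le> N"
      using supp[of j] by simp
  qed
  have "skeleton v N h (Suc n) \<phi> =
      (\<Sum>j\<le>N. \<integral>\<omega>. \<Phi> j (\<lambda>k. X (real k * h) \<omega>) * of_bool (X (real (Suc n) * h) \<omega> = j) \<partial>M)"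
    unfolding skeleton_def 1
    by (rule Bochner_Integration.integral_sum) (rule markov_step(2)[OF h, of n _ N, OF dep supp])
  also have "\<dots> = (\<Sum>j\<le>N. \<integral>\<omega>. \<Phi> j (\<lambda>k. X (real k * h) \<omega>) * p h (X (real n * h) \<omega>) j \<partial>M)"
    by (intro sum.cong refl markov_step(3)[OF h, of n _ N, OF dep supp])
  also have "\<dots> = (\<integral>\<omega>. (\<Sum>j\<le>N. \<Phi> j (\<lambda>k. X (real k * h) \<omega>) * p h (X (real n * h) \<omega>) j) \<partial>M)"
    by (rule Bochner_Integration.integral_sum[symmetric]) (rule int)
  also have "\<dots> = skeleton v N h n (weighted_step v N h \<phi>)"
    unfolding skeleton_def 2[of "\<lambda>k. X (real k * h) _"] by simp
  finally show ?thesis .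
qed

text \<open>Monotonicity lets the one-step bound be inserted under the functional. As
  \<open>\<phi>\<close> may have any sign, the same bound serves the positive functions and the
  negative of a subharmonic one.\<close>

lemma skeleton_le_power:
  assumes "0 < h" "0 \<le> v" "1 \<le> N" "0 \<le> c"
    and step: "\<And>i. i \<le> N \<Longrightarrow> weighted_step v N h \<phi> i \<le> c * \<phi> i"
  shows "skeleton v N h n \<phi> \<le> c ^ n * \<phi> 1"
proof (induction n)
  case (Suc n)
  have "skeleton v N h (Suc n) \<phi> \<le> c * skeleton v N h n \<phi>"
    using assms skeleton_mono[of h v N "weighted_step v N h \<phi>" "\<lambda>i. c * \<phi> i" n]
    by (simp add: skeleton_Suc skeleton_scale)
  also have "\<dots> \<le> c * (c ^ n * \<phi> 1)" using Suc \<open>0 \<le> c\<close> by (rule mult_left_mono)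
  finally show ?case by (simp add: mult_ac)
qed (use assms in \<open>simp add: skeleton_0\<close>)

subsection \<open>Absorption and measurability\<close>

definition absorbed :: "(real \<Rightarrow> nat) \<Rightarrow> bool" where
  "absorbed x \<longleftrightarrow> (\<forall>s t. 0 \<le> s \<longrightarrow> s \<le> t \<longrightarrow> x s = 0 \<longrightarrow> x t = 0)"

section \<open>The truncated generator and the absorbing state\<close>

lemma p_nonneg: "0 \<le> t \<Longrightarrow> 0 \<le> p t i j"
  and p_sums: "0 \<le> t \<Longrightarrow> p t i sums 1"
  and p_0: "p 0 i j = (if i = j then 1 else 0)"
  and p_add: "0 \<le> s \<Longrightarrow> 0 \<le> t \<Longrightarrow> (\<lambda>k. p s i k * p t k j) sums p (s + t) i j"
  using p_transition unfolding transition_function_def by blast+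

lemma p_deriv: "((\<lambda>t. p t i j) has_real_derivative branching_Q b w i j) (at 0 within {0..})"
  using p_Q unfolding has_Q_matrix_def by blast

definition generator :: "real \<Rightarrow> nat \<Rightarrow> (nat \<Rightarrow> real) \<Rightarrow> nat \<Rightarrow> real" where
  "generator v N \<phi> i = (\<Sum>j\<le>N. branching_Q b w i j * step_weight v N i j * \<phi> j)"

lemma weighted_step_deriv:
  "((\<lambda>h. weighted_step v N h \<phi> i) has_real_derivative generator v N \<phi> i) (at 0 within {0..})"
  unfolding weighted_step_def generator_def
  by (intro DERIV_sum DERIV_cmult_right p_deriv)

lemma weighted_step_0: "i \<le> N \<Longrightarrow> weighted_step v N 0 \<phi> i = \<phi> i"
proof -
  assume i: "i \<le> N"
  have "weighted_step v N 0 \<phi> i = (\<Sum>j\<le>N. if i = j then \<phi> j else 0)"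
    unfolding weighted_step_def
    by (intro sum.cong refl) (use i m_gt_1 in \<open>auto simp: p_0 step_weight_def\<close>)
  then show ?thesis using i by simp
qed

text \<open>Strictness absorbs the o(h), uniformly over the finitely many states. The second
  alternative serves a state where both sides vanish and no strict slack is possible, as happens for
  1 - \<delta>^i at \<open>i = 0\<close>.\<close>

lemma eventually_weighted_step_le:
  assumes "\<And>i. i \<le> N \<Longrightarrow>
      generator v N \<phi> i < c * \<phi> i \<or> (\<forall>h\<ge>0. weighted_step v N h \<phi> i \<le> (1 + c * h) * \<phi> i)"
  shows "\<forall>\<^sub>F h in at_right 0. \<forall>i\<le>N. weighted_step v N h \<phi> i \<le> (1 + c * h) * \<phi> i"
proof -
  have "\<forall>\<^sub>F h in at_right 0. weighted_step v N h \<phi> i \<le> (1 + c * h) * \<phi> i" if i: "i \<in> {..N}" for i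
  proof (cases "generator v N \<phi> i < c * \<phi> i")
    case True
    from at_right_lt_linear[OF weighted_step_deriv this] show ?thesis
      by eventually_elim (use i in \<open>simp add: weighted_step_0 algebra_simps\<close>)
  next
    case False
    then have "\<forall>h\<ge>0. weighted_step v N h \<phi> i \<le> (1 + c * h) * \<phi> i" using assms i by blast
    then show ?thesis using eventually_at_right_less[of 0] by (auto elim!: eventually_mono)
  qed
  then have "\<forall>\<^sub>F h in at_right 0. \<forall>i\<in>{..N}. weighted_step v N h \<phi> i \<le> (1 + c * h) * \<phi> i"
    by (rule eventually_ball_finite[OF finite_atMost, OF ballI])
  then show ?thesis by (simp add: Ball_def)
qed

lemma branching_Q_0: "branching_Q b w 0 j = 0"
  by (simp add: branching_Q_def)

text \<open>A zero derivative at time 0 gives p_h(0,0) > 1 - \<epsilon> h for small h only.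
  Chapman-Kolmogorov along n steps of length t/n and Bernoulli carry this to 1 - \<epsilon> t at any
  t, and \<epsilon> tends to 0. The row sum then leaves nothing for the other states.\<close>

lemma p_absorbing: assumes "0 \<le> t" shows "p t 0 j = (if j = 0 then 1 else 0)"
proof -
  have le1: "p t i j \<le> 1" if "0 \<le> t" for t i j
    using sum_le_suminf[of "p t i" "{j}"] p_sums[OF that, of i] p_nonneg[OF that]
    by (simp add: sums_iff)
  have mult: "p s 0 0 * p t 0 0 \<le> p (s + t) 0 0" if "0 \<le> s" "0 \<le> t" for s t
    using sum_le_suminf[of "\<lambda>k. p s 0 k * p t k 0" "{0}"] p_add[OF that, of 0 0] p_nonneg that
    by (simp add: sums_iff)
  have pow: "p h 0 0 ^ n \<le> p (real n * h) 0 0" if "0 \<le> h" for h n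
  proof (induction n)
    case (Suc n)
    have "p h 0 0 ^ Suc n \<le> p h 0 0 * p (real n * h) 0 0"
      using Suc p_nonneg[OF that] by (simp add: mult_left_mono)
    also have "\<dots> \<le> p (h + real n * h) 0 0" by (rule mult) (use that in auto)
    finally show ?case by (simp add: algebra_simps)
  qed (simp add: p_0)
  have lower: "1 - \<epsilon> * t \<le> p t 0 0" if "0 < \<epsilon>" "0 < t" for \<epsilon>
  proof -
    have "((\<lambda>t. - p t 0 0) has_real_derivative - 0) (at 0 within {0..})"
      using p_deriv[of 0 0] unfolding branching_Q_0 by (rule DERIV_minus)
    from at_right_lt_linear[OF this, of \<epsilon>] that
    have "\<forall>\<^sub>F h in at_right 0. 1 - \<epsilon> * h < p h 0 0"
      by (auto simp: p_0 elim!: eventually_mono)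
    moreover have "((\<lambda>h. \<epsilon> * h) \<longlongrightarrow> \<epsilon> * 0) (at_right 0)" by (intro tendsto_intros)
    then have "\<forall>\<^sub>F h in at_right 0. \<epsilon> * h < 1"
      by (rule order_tendstoD) simp
    ultimately have "\<forall>\<^sub>F h in at_right 0. 1 - \<epsilon> * h < p h 0 0 \<and> \<epsilon> * h < 1"
      by (rule eventually_conj)
    from eventually_mesh[OF \<open>0 < t\<close> this] eventually_gt_at_top[of 0]
    have "\<forall>\<^sub>F n in sequentially. 1 - \<epsilon> * t \<le> p t 0 0"
    proof eventually_elim
      case (elim n)
      have "1 - \<epsilon> * t = 1 + real n * (- (\<epsilon> * (t / real n)))" using elim by simp
      also have "\<dots> \<le> (1 + (- (\<epsilon> * (t / real n)))) ^ n"
        by (rule Bernoulli_inequality) (use elim in simp)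
      also have "\<dots> \<le> p (t / real n) 0 0 ^ n" by (rule power_mono) (use elim in auto)
      also have "\<dots> \<le> p (real n * (t / real n)) 0 0" by (rule pow) (use that in simp)
      finally show ?case using elim by simp
    qed
    then show ?thesis by simp
  qed
  have p00: "p t 0 0 = 1"
  proof (cases "t = 0")
    case False
    have "((\<lambda>\<epsilon>. 1 - \<epsilon> * t) \<longlongrightarrow> 1 - 0 * t) (at_right 0)" by (intro tendsto_intros)
    then have "1 - 0 * t \<le> p t 0 0"
      by (rule tendsto_upperbound)
      (use lower False assms eventually_at_right_less[of "0::real"] in \<open>auto elim!: eventually_mono\<close>)
    then show ?thesis using le1[OF assms, of 0 0] by simp
  qed (simp add: p_0)
  show ?thesis
  proof (cases "j = 0")
    case False
    have "(\<Sum>k\<in>{0, j}. p t 0 k) \<le> 1"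
      using sum_le_suminf[of "p t 0" "{0, j}"] p_sums[OF assms, of 0] p_nonneg[OF assms]
      by (simp add: sums_iff)
    then show ?thesis using False p00 p_nonneg[OF assms, of 0 j] by simp
  qed (simp add: p00)
qed

text \<open>For each pair of rational times and each nonzero state the violating event is null, and
  there are countably many. Real times s < t are reached through a rational just after s, still
  before t, and one just after t.\<close>

lemma AE_absorbed: "AE \<omega> in M. absorbed (\<lambda>t. X t \<omega>)"
proof -
  have "AE \<omega> in M. 0 \<le> q \<and> q < r \<longrightarrow> X (of_rat q) \<omega> = 0 \<longrightarrow> X (of_rat r) \<omega> = 0" for q r :: rat
  proof (cases "0 \<le> q \<and> q < r")
    case True
    define t where "t k = (if k = 0 then of_rat q else of_rat r :: real)" for k :: nat
    have r0: "(0::real) \<le> of_rat q" "(0::real) \<le> of_rat r" "of_rat q < (of_rat r :: real)"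
      using True by (simp_all add: of_rat_less)
    have "AE \<omega> in M. \<not> (X (of_rat q) \<omega> = 0 \<and> X (of_rat r) \<omega> = j)" if "j \<noteq> 0" for j
    proof -
      define i where "i k = (if k = 0 then 0 else j)" for k :: nat
      have "prob {\<omega> \<in> space M. \<forall>k\<le>Suc 0. X (t k) \<omega> = i k} =
          prob {\<omega> \<in> space M. \<forall>k\<le>0. X (t k) \<omega> = i k} * p (t (Suc 0) - t 0) (i 0) (i (Suc 0))"
        by (rule X_markov[unfolded markov_property_def, rule_format]) (use r0 in \<open>auto simp: t_def\<close>)
      also have "p (t (Suc 0) - t 0) (i 0) (i (Suc 0)) = 0"
        using p_absorbing[of "of_rat r - of_rat q" j] r0 that by (simp add: t_def i_def)
      also have "{\<omega> \<in> space M. \<forall>k\<le>Suc 0. X (t k) \<omega> = i k} =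
          {\<omega> \<in> space M. X (of_rat q) \<omega> = 0 \<and> X (of_rat r) \<omega> = j}"
        by (auto simp: t_def i_def le_Suc_eq)
      finally have "prob {\<omega> \<in> space M. X (of_rat q) \<omega> = 0 \<and> X (of_rat r) \<omega> = j} = 0"
        by simp
      moreover have "{\<omega> \<in> space M. X (of_rat q) \<omega> = 0 \<and> X (of_rat r) \<omega> = j} \<in> events"
        by (intro sets.sets_Collect_conj X_event r0)
      ultimately show ?thesis by (simp add: prob_eq_0)
    qed
    then have "AE \<omega> in M. \<forall>j. j \<noteq> 0 \<longrightarrow> \<not> (X (of_rat q) \<omega> = 0 \<and> X (of_rat r) \<omega> = j)"
      by (subst AE_all_countable) auto
    then show ?thesis by eventually_elim auto
  qed auto
  then have "AE \<omega> in M. \<forall>q r :: rat. 0 \<le> q \<and> q < r \<longrightarrow> X (of_rat q) \<omega> = 0 \<longrightarrow> X (of_rat r) \<omega> = 0"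
    by (simp add: AE_all_countable)
  with AE_space show ?thesis
  proof eventually_elim
    case (elim \<omega>)
    let ?x = "\<lambda>t. X t \<omega>"
    have x: "regular_path ?x" using elim by (rule_tac X_regular)
    show ?case
      unfolding absorbed_def
    proof (intro allI impI)
      fix s t :: real assume st: "0 \<le> s" "s \<le> t" "X s \<omega> = 0"
      show "X t \<omega> = 0"
      proof (cases "s = t")
        case False
        then obtain q where q: "s < of_rat q" "of_rat q < t" "X (of_rat q) \<omega> = X s \<omega>"
          using regular_path_rat_after[OF x, of s t] st by auto
        obtain r where r: "t < of_rat r" "of_rat r < t + 1" "X (of_rat r) \<omega> = X t \<omega>"
          using regular_path_rat_after[OF x, of t "t + 1"] st by auto
        have "(0 :: real) \<le> of_rat q" "(of_rat q :: real) < of_rat r" using q r st by linarith+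
        then have "0 \<le> q" "q < r" by (simp_all add: of_rat_less)
        then show ?thesis using elim q r st by metis
      qed (use st in simp)
    qed
  qed
qed

section \<open>Measurability of the extinction time and of the crossing number\<close>

lemma extinction_time_attained:
  assumes x: "regular_path (\<lambda>t. X t \<omega>)" and "0 \<le> t" "X t \<omega> = 0"
  obtains s where "extinction_time X \<omega> = ereal s" "0 \<le> s" "s \<le> t" "X s \<omega> = 0"
proof -
  define A where "A = {t. 0 \<le> t \<and> X t \<omega> = 0}"
  have A: "t \<in> A" "bdd_below A" using assms by (auto simp: A_def intro!: bdd_belowI[of _ 0])
  have "extinction_time X \<omega> = ereal (Inf A)"
    unfolding extinction_time_def A_def[symmetric] using A by (subst ereal_Inf') auto
  moreover have "0 \<le> Inf A" using A by (intro cInf_greatest) (auto simp: A_def)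
  moreover have "Inf A \<le> t" using A by (rule_tac cInf_lower)
  \<comment> \<open>Zeros lie arbitrarily close to the infimum, either at it or to its right, where
    the path has the value it takes at the infimum.\<close>
  moreover have "X (Inf A) \<omega> = 0"
  proof -
    have "\<forall>\<^sub>F r in at_right (Inf A). X r \<omega> = X (Inf A) \<omega>"
      by (rule regular_path_right_const[OF x \<open>0 \<le> Inf A\<close>])
    then obtain d where d: "d > Inf A" "\<And>r. Inf A < r \<Longrightarrow> r < d \<Longrightarrow> X r \<omega> = X (Inf A) \<omega>"
      unfolding eventually_at_right_field by blast
    obtain r where r: "r \<in> A" "r < d" using cInf_lessD[of A d] A d by auto
    moreover have "Inf A \<le> r" using A r by (intro cInf_lower)
    ultimately show ?thesis using d by (cases "r = Inf A") (auto simp: A_def)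
  qed
  ultimately show ?thesis using that by blast
qed

lemma extinction_time_finite_iff:
  assumes "regular_path (\<lambda>t. X t \<omega>)"
  shows "extinction_time X \<omega> < \<infinity> \<longleftrightarrow> (\<exists>t\<ge>0. X t \<omega> = 0)"
proof
  assume fin: "extinction_time X \<omega> < \<infinity>"
  have "{t. 0 \<le> t \<and> X t \<omega> = 0} \<noteq> {}"
  proof
    assume e: "{t. 0 \<le> t \<and> X t \<omega> = 0} = {}"
    have "extinction_time X \<omega> = \<infinity>" unfolding extinction_time_def e by (simp add: top_ereal_def)
    then show False using fin by simp
  qed
  then show "\<exists>t\<ge>0. X t \<omega> = 0" by blast
next
  assume "\<exists>t\<ge>0. X t \<omega> = 0"
  then obtain t where t: "0 \<le> t" "X t \<omega> = 0" by blast
  obtain s where "extinction_time X \<omega> = ereal s" using extinction_time_attained[OF assms t] by blast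
  then show "extinction_time X \<omega> < \<infinity>" by simp
qed

text \<open>A zero before \<open>g\<close> is held for a while, hence also seen at a rational time
  before \<open>g\<close>. This gives the event as a countable intersection.\<close>

lemma le_extinction_time_iff:
  assumes x: "regular_path (\<lambda>t. X t \<omega>)"
  shows "ereal g \<le> extinction_time X \<omega> \<longleftrightarrow> (\<forall>q::rat. 0 \<le> q \<longrightarrow> of_rat q < g \<longrightarrow> X (of_rat q) \<omega> \<noteq> 0)"
proof
  assume L: "ereal g \<le> extinction_time X \<omega>"
  show "\<forall>q::rat. 0 \<le> q \<longrightarrow> of_rat q < g \<longrightarrow> X (of_rat q) \<omega> \<noteq> 0"
  proof (intro allI impI notI)
    fix q :: rat assume q: "0 \<le> q" "of_rat q < g" "X (of_rat q) \<omega> = 0"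
    then have "(0::real) \<le> of_rat q" by simp
    from extinction_time_attained[OF x this q(3)]
    obtain s where "extinction_time X \<omega> = ereal s" "s \<le> of_rat q" by blast
    then have "g \<le> of_rat q" using L by simp
    then show False using q(2) by simp
  qed
next
  assume R: "\<forall>q::rat. 0 \<le> q \<longrightarrow> of_rat q < g \<longrightarrow> X (of_rat q) \<omega> \<noteq> 0"
  show "ereal g \<le> extinction_time X \<omega>"
  proof (rule ccontr)
    assume "\<not> ?thesis"
    then obtain t where t: "0 \<le> t" "X t \<omega> = 0" "t < g"
      by (auto simp: extinction_time_def INF_less_iff not_le)
    obtain q where "t < of_rat q" "of_rat q < g" "X (of_rat q) \<omega> = X t \<omega>"
      using regular_path_rat_after[OF x t(1,3)] .
    moreover from this have "(0::real) \<le> of_rat q" using t by linarith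
    then have "0 \<le> q" by simp
    ultimately show False using R t by simp
  qed
qed

lemma le_extinction_time_event: "{\<omega> \<in> space M. ereal g \<le> extinction_time X \<omega>} \<in> events"
proof -
  have "{\<omega> \<in> space M. ereal g \<le> extinction_time X \<omega>} =
      {\<omega> \<in> space M. \<forall>q::rat. 0 \<le> q \<longrightarrow> of_rat q < g \<longrightarrow> X (of_rat q) \<omega> \<noteq> 0}"
    using le_extinction_time_iff[OF X_regular] by blast
  also have "\<dots> \<in> events"
  proof (rule sets.sets_Collect_countable_All)
    fix q :: rat
    show "{\<omega> \<in> space M. 0 \<le> q \<longrightarrow> of_rat q < g \<longrightarrow> X (of_rat q) \<omega> \<noteq> 0} \<in> events"
      using X_event[of "of_rat q" "\<lambda>i. i \<noteq> 0"] by (cases "0 \<le> q \<and> of_rat q < g") auto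
  qed
  finally show ?thesis .
qed

lemma extinction_event: "{\<omega> \<in> space M. extinction_time X \<omega> < \<infinity>} \<in> events"
proof -
  have *: "extinction_time X \<omega> < \<infinity> \<longleftrightarrow> (\<exists>n::nat. \<not> ereal (real n) \<le> extinction_time X \<omega>)" for \<omega>
  proof
    assume "extinction_time X \<omega> < \<infinity>"
    then obtain n where "extinction_time X \<omega> < ereal (real n)"
      using less_PInf_Ex_of_nat[of "extinction_time X \<omega>"] by auto
    then show "\<exists>n::nat. \<not> ereal (real n) \<le> extinction_time X \<omega>" by (auto simp: not_le)
  qed (auto simp: not_le less_top[symmetric])
  show ?thesis unfolding *
    by (intro sets.sets_Collect_countable_Ex sets.sets_Collect_neg le_extinction_time_event)
qed

text \<open>The cut at \<open>T\<close> makes the set finite. Without it a path that never dies out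
  may have infinitely many jumps, for which \<open>card\<close> returns 0.\<close>

definition jumps_before :: "real \<Rightarrow> 'a \<Rightarrow> real set" where
  "jumps_before T \<omega> = {s. 0 < s \<and> s \<le> T \<and> ereal s \<le> extinction_time X \<omega> \<and>
      jump_at (\<lambda>t. X t \<omega>) (int m - 1) s}"

lemma finite_jumps_before:
  assumes "\<omega> \<in> space M" "0 \<le> T"
  shows "finite (jumps_before T \<omega>)"
proof (rule finite_subset)
  show "jumps_before T \<omega> \<subseteq> {s. 0 < s \<and> s \<le> T \<and> \<not> isCont (\<lambda>t. X t \<omega>) s}"
    using jump_at_not_isCont m_gt_1 by (fastforce simp: jumps_before_def)
  show "finite {s. 0 < s \<and> s \<le> T \<and> \<not> isCont (\<lambda>t. X t \<omega>) s}"
    using X_regular[OF assms(1)] assms(2) by (auto simp: regular_path_def)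
qed

text \<open>The path arrives at 0 there, while a jump of positive size m - 1 ends above 0. This
  supplies the condition on the bound in the grid count.\<close>

lemma no_jump_at_extinction:
  assumes x: "regular_path (\<lambda>t. X t \<omega>)" and "ereal s = extinction_time X \<omega>"
  shows "\<not> jump_at (\<lambda>t. X t \<omega>) (int m - 1) s"
proof -
  have "extinction_time X \<omega> < \<infinity>" using assms(2)[symmetric] by simp
  then obtain t where t: "0 \<le> t" "X t \<omega> = 0" using extinction_time_finite_iff[OF x] by blast
  obtain s' where "extinction_time X \<omega> = ereal s'" "X s' \<omega> = 0"
    using extinction_time_attained[OF x t] by blast
  then have "X s \<omega> = 0" using assms(2) by simp
  then show ?thesis using m_gt_1 by (auto simp: jump_at_def)
qed

text \<open>The grid counts are measurable and eventually equal to the number of jumps, so the event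
  is the limit inferior of measurable events.\<close>

lemma jumps_before_event:
  assumes T: "0 < T"
  shows "{\<omega> \<in> space M. card (jumps_before T \<omega>) = k} \<in> events"
proof -
  define C where "C n \<omega> = card {k. k < n \<and> ereal (grid T n (Suc k)) \<le> extinction_time X \<omega> \<and>
    int (X (grid T n (Suc k)) \<omega>) - int (X (grid T n k) \<omega>) = int m - 1}" for n \<omega>
  have ev: "\<forall>\<^sub>F n in sequentially. C n \<omega> = card (jumps_before T \<omega>)" if "\<omega> \<in> space M" for \<omega>
    unfolding C_def jumps_before_def
    by (rule eventually_grid_count[OF X_regular[OF that] T])
      (use m_gt_1 no_jump_at_extinction[OF X_regular[OF that]] in auto)
  have iff: "card (jumps_before T \<omega>) = k \<longleftrightarrow> (\<exists>n0. \<forall>n. n \<ge> n0 \<longrightarrow> C n \<omega> = k)" if "\<omega> \<in> space M" for \<omega>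
  proof
    assume "card (jumps_before T \<omega>) = k"
    then show "\<exists>n0. \<forall>n. n \<ge> n0 \<longrightarrow> C n \<omega> = k" using ev[OF that] by
      (auto simp: eventually_at_top_linorder)
  next
    assume "\<exists>n0. \<forall>n. n \<ge> n0 \<longrightarrow> C n \<omega> = k"
    then have "\<forall>\<^sub>F n in sequentially. C n \<omega> = k" by (simp add: eventually_at_top_linorder)
    with ev[OF that] have "\<forall>\<^sub>F n in sequentially. card (jumps_before T \<omega>) = k"
      by eventually_elim simp
    then show "card (jumps_before T \<omega>) = k" by simp
  qed
  have diff: "{\<omega> \<in> space M. int (X s \<omega>) - int (X r \<omega>) = int m - 1} \<in> events" if "0 \<le> s" "0 \<le> r"
    for s r
  proof -
    have "{\<omega> \<in> space M. int (X s \<omega>) - int (X r \<omega>) = int m - 1} =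
        {\<omega> \<in> space M. \<exists>i. X r \<omega> = i \<and> int (X s \<omega>) - int i = int m - 1}" by auto
    also have "\<dots> \<in> events"
      by (intro sets.sets_Collect_countable_Ex sets.sets_Collect_conj X_event that)
    finally show ?thesis .
  qed
  have g: "0 \<le> grid T n k" for n k using T by (simp add: grid_def)
  have "C n \<in> measurable M (count_space UNIV)" for n
    unfolding C_def
  proof (rule measurable_card)
    fix k
    show "{\<omega> \<in> space M. k \<in> {k. k < n \<and> ereal (grid T n (Suc k)) \<le> extinction_time X \<omega> \<and>
        int (X (grid T n (Suc k)) \<omega>) - int (X (grid T n k) \<omega>) = int m - 1}} \<in> events"
      unfolding mem_Collect_eq
      by (intro sets.sets_Collect_conj sets.sets_Collect_const le_extinction_time_event diff g)
  qed
  then have "{\<omega> \<in> space M. C n \<omega> = k} \<in> events" for n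
    using measurable_sets[of "C n" M "count_space UNIV" "{k}"]
    by (simp add: vimage_def Int_def conj_commute)
  then have "{\<omega> \<in> space M. \<exists>n0. \<forall>n. n \<ge> n0 \<longrightarrow> C n \<omega> = k} \<in> events"
    by (intro sets.sets_Collect_countable_Ex sets.sets_Collect_countable_All sets.sets_Collect_imp sets.sets_Collect_const)
  also have "{\<omega> \<in> space M. \<exists>n0. \<forall>n. n \<ge> n0 \<longrightarrow> C n \<omega> = k} = {\<omega> \<in> space M. card (jumps_before T \<omega>) =
      k}"
    using iff by blast
  finally show ?thesis .
qed

text \<open>The value 0 is ambiguous, since \<open>card\<close> is also 0 on infinite sets. Positive
  values are recognised by the counts up to finite times becoming constant, and 0 is what
  remains.\<close>

lemma total_crossings_measurable: "total_crossings X m \<in> measurable M (count_space UNIV)"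
proof -
  define J where "J \<omega> = {s. 0 < s \<and> ereal s \<le> extinction_time X \<omega> \<and>
      jump_at (\<lambda>t. X t \<omega>) (int m - 1) s}" for \<omega>
  have total: "total_crossings X m \<omega> = card (J \<omega>)" for \<omega>
    by (simp add: total_crossings_def crossings_def J_def)
  let ?Jn = "\<lambda>n \<omega>. jumps_before (real (Suc n)) \<omega>"
  have mono: "?Jn n \<omega> \<subseteq> ?Jn n' \<omega>" if "n \<le> n'" for n n' \<omega> using that by (auto simp: jumps_before_def)
  have sub: "?Jn n \<omega> \<subseteq> J \<omega>" for n \<omega> by (auto simp: jumps_before_def J_def)
  have ex: "\<exists>n. s \<in> ?Jn n \<omega>" if "s \<in> J \<omega>" for s \<omega>
  proof -
    obtain n where "s \<le> real n" using real_arch_simple by blast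
    then show ?thesis using that by (intro exI[of _ n]) (auto simp: jumps_before_def J_def)
  qed
  have iff: "total_crossings X m \<omega> = k \<longleftrightarrow> (\<exists>n0. \<forall>n. n \<ge> n0 \<longrightarrow> card (?Jn n \<omega>) = k)"
    if \<omega>: "\<omega> \<in> space M" and k: "0 < k" for \<omega> k
  proof
    assume "total_crossings X m \<omega> = k"
    then have card: "card (J \<omega>) = k" and fin: "finite (J \<omega>)" using k total card_ge_0_finite by auto
    have "\<forall>s. \<exists>n. s \<in> J \<omega> \<longrightarrow> s \<in> ?Jn n \<omega>" using ex by blast
    then have "\<exists>f. \<forall>s. s \<in> J \<omega> \<longrightarrow> s \<in> ?Jn (f s) \<omega>" by (rule choice)
    then obtain f where f: "\<And>s. s \<in> J \<omega> \<Longrightarrow> s \<in> ?Jn (f s) \<omega>" by blast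
    have "J \<omega> = ?Jn n \<omega>" if "Max (f ` J \<omega>) \<le> n" for n
    proof
      show "J \<omega> \<subseteq> ?Jn n \<omega>"
      proof
        fix s assume s: "s \<in> J \<omega>"
        then have "f s \<le> n" using that fin by (meson Max_ge finite_imageI imageI order_trans)
        then show "s \<in> ?Jn n \<omega>" using f[OF s] mono by blast
      qed
    qed (rule sub)
    then show "\<exists>n0. \<forall>n. n \<ge> n0 \<longrightarrow> card (?Jn n \<omega>) = k" using card by metis
  next
    assume "\<exists>n0. \<forall>n. n \<ge> n0 \<longrightarrow> card (?Jn n \<omega>) = k"
    then obtain n0 where n0: "\<And>n. n \<ge> n0 \<Longrightarrow> card (?Jn n \<omega>) = k" by blast
    have "J \<omega> = ?Jn n0 \<omega>"
    proof
      show "J \<omega> \<subseteq> ?Jn n0 \<omega>"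
      proof
        fix s assume "s \<in> J \<omega>"
        then obtain n where n: "s \<in> ?Jn n \<omega>" using ex by blast
        \<comment> \<open>Nested finite sets of the same cardinality coincide, so no jump is added
          after the counts have settled.\<close>
        have "?Jn n0 \<omega> = ?Jn (max n n0) \<omega>"
          using n0[of "max n n0"] n0[of n0] mono[of n0 "max n n0"] finite_jumps_before[OF \<omega>]
          by (intro card_subset_eq) simp_all
        then show "s \<in> ?Jn n0 \<omega>" using n mono[of n "max n n0" \<omega>] by auto
      qed
    qed (rule sub)
    then show "total_crossings X m \<omega> = k" using n0[of n0] by (simp add: total)
  qed
  have pos: "{\<omega> \<in> space M. total_crossings X m \<omega> = k} \<in> events" if "0 < k" for k
  proof -
    have "{\<omega> \<in> space M. total_crossings X m \<omega> = k} = {\<omega> \<in> space M. \<exists>n0. \<forall>n. n \<ge> n0 \<longrightarrow>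
        card (?Jn n \<omega>) = k}"
      using iff[OF _ that] by blast
    also have "\<dots> \<in> events"
      by (intro sets.sets_Collect_countable_Ex sets.sets_Collect_countable_All sets.sets_Collect_imp
          sets.sets_Collect_const jumps_before_event) simp
    finally show ?thesis .
  qed
  have "{\<omega> \<in> space M. total_crossings X m \<omega> = k} \<in> events" for k
  proof (cases "k = 0")
    case True
    have "n = k \<longleftrightarrow> (\<forall>l. \<not> n = Suc l)" for n using True by (cases n) auto
    then have "{\<omega> \<in> space M. total_crossings X m \<omega> = k} =
        {\<omega> \<in> space M. \<forall>l. \<not> total_crossings X m \<omega> = Suc l}"
      by blast
    also have "\<dots> \<in> events"
      by (intro sets.sets_Collect_countable_All sets.sets_Collect_neg pos) simp
    finally show ?thesis .
  qed (use pos in auto)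
  then show ?thesis
    by (subst measurable_count_space_eq2_countable) (auto simp: vimage_def Int_def conj_commute)
qed

subsection \<open>The generating function of the crossing number\<close>

text \<open>The continuous-time limit of the path weights for the indicator of 0. Counting up to
  \<open>T\<close> instead of up to extinction makes no difference on almost every path with
  \<open>X T \<omega> = 0\<close>.\<close>

definition gf_event_weight :: "real \<Rightarrow> real \<Rightarrow> nat \<Rightarrow> 'a \<Rightarrow> real" where
  "gf_event_weight v T N \<omega> =
     v ^ card {s. 0 < s \<and> s \<le> T \<and> jump_at (\<lambda>t. X t \<omega>) (int m - 1) s} *
     of_bool ((\<forall>t\<in>{0..T}. X t \<omega> \<le> N) \<and> X T \<omega> = 0)"

text \<open>The function F of the overview. It is not divided by the extinction probability, because
  the unnormalised function is the one that solves B_v(F(v)) = 0.\<close>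

definition crossing_gf :: "real \<Rightarrow> real" where
  "crossing_gf v = (\<integral>\<omega>. v ^ total_crossings X m \<omega> * of_bool (extinction_time X \<omega> < \<infinity>) \<partial>M)"

lemma path_weight_indicator:
  "path_weight v N n (\<lambda>i. of_bool (i = 0)) x =
    v ^ card {k. k < n \<and> int (x (Suc k)) - int (x k) = int m - 1} * of_bool ((\<forall>k\<le>n. x k \<le> N) \<and> x n = 0)"
proof (cases "\<forall>k\<le>n. x k \<le> N")
  case True
  have "step_weight v N (x k) (x (Suc k)) = (if int (x (Suc k)) - int (x k) =
      int m - 1 then v else 1)"
    if "k < n" for k
    using True that by (auto simp: step_weight_def)
  then have "(\<Prod>k<n. step_weight v N (x k) (x (Suc k))) =
      (\<Prod>k<n. if int (x (Suc k)) - int (x k) = int m - 1 then v else 1)"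
    by (intro prod.cong) auto
  also have "\<dots> = v ^ card {k. k < n \<and> int (x (Suc k)) - int (x k) = int m - 1}"
    by (simp add: prod.If_cases Int_def)
  finally show ?thesis using True by (simp add: path_weight_def)
next
  case False
  then have "path_weight v N n (\<lambda>i. of_bool (i = 0)) x = 0" using path_weight_support by blast
  then show ?thesis using False by simp
qed

text \<open>On each path the grid functional equals its limit for all large n; the bound 1 then
  allows dominated convergence.\<close>

lemma gf_event_weight_limit:
  assumes v: "0 \<le> v" "v \<le> 1" and T: "0 < T"
  shows "gf_event_weight v T N \<in> borel_measurable M"
    and "(\<lambda>n. skeleton v N (T / real n) n (\<lambda>i. of_bool (i = 0))) \<longlonglongrightarrow> (\<integral>\<omega>. gf_event_weight v T N \<omega> \<partial>M)"
proof -
  \<comment> \<open>The shift to \<open>Suc n\<close> avoids \<open>n = 0\<close>, where the mesh T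
    / 0 is 0 and not positive.\<close>
  define G where "G n \<omega> = path_weight v N (Suc n) (\<lambda>i. of_bool (i =
      0)) (\<lambda>k. X (grid T (Suc n) k) \<omega>)" for n \<omega>
  have lim: "(\<lambda>n. G n \<omega>) \<longlonglongrightarrow> gf_event_weight v T N \<omega>" if \<omega>: "\<omega> \<in> space M" for \<omega>
  proof -
    have count: "\<forall>\<^sub>F n in sequentially.
        card {k. k < n \<and> ereal (grid T n (Suc k)) \<le> \<infinity> \<and> int (X (grid T n (Suc k)) \<omega>) - int (X (grid T n k) \<omega>) = int m - 1} =
        card {s. 0 < s \<and> s \<le> T \<and> ereal s \<le> \<infinity> \<and> jump_at (\<lambda>t. X t \<omega>) (int m - 1) s}"
      by (rule eventually_grid_count[OF X_regular[OF \<omega>] T]) (use m_gt_1 in auto)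
    have "\<forall>\<^sub>F n in sequentially.
        path_weight v N n (\<lambda>i. of_bool (i = 0)) (\<lambda>k. X (grid T n k) \<omega>) = gf_event_weight v T N \<omega>"
      using count regular_path_grid_sees_values[OF X_regular[OF \<omega>] T, of "\<lambda>i. i \<le> N"] eventually_gt_at_top[of 0]
      unfolding path_weight_indicator gf_event_weight_def
    proof eventually_elim
      case (elim n)
      then show ?case using m_gt_1 by (simp add: grid_def)
    qed
    then have "\<forall>\<^sub>F n in sequentially. G n \<omega> = gf_event_weight v T N \<omega>"
      unfolding G_def by (subst eventually_sequentially_Suc)
    then show ?thesis by (rule tendsto_eventually)
  qed
  have G_int: "integrable M (G n)" for n
  proof -
    have "integrable M (\<lambda>\<omega>. G n \<omega>)"
      unfolding G_def grid_def by (rule integrable_path_weight) (use T in simp)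
    then show ?thesis by simp
  qed
  show meas: "gf_event_weight v T N \<in> borel_measurable M"
    by (rule borel_measurable_LIMSEQ_real[OF lim]) (use G_int in auto)
  have "(\<lambda>n. \<integral>\<omega>. G n \<omega> \<partial>M) \<longlonglongrightarrow> (\<integral>\<omega>. gf_event_weight v T N \<omega> \<partial>M)"
  proof (rule integral_dominated_convergence[where w = "\<lambda>_. 1"])
    show "AE \<omega> in M. norm (G n \<omega>) \<le> 1" for n
      using v by (auto simp: G_def path_weight_indicator power_le_one)
  qed (use G_int meas lim in auto)
  then have "(\<lambda>n. skeleton v N (T / real (Suc n)) (Suc n) (\<lambda>i. of_bool (i = 0))) \<longlonglongrightarrow>
      (\<integral>\<omega>. gf_event_weight v T N \<omega> \<partial>M)"
    by (simp add: G_def skeleton_def grid_def)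
  then show "(\<lambda>n. skeleton v N (T / real n) n (\<lambda>i. of_bool (i = 0))) \<longlonglongrightarrow>
      (\<integral>\<omega>. gf_event_weight v T N \<omega> \<partial>M)"
    by (rule LIMSEQ_imp_Suc)
qed

lemma integrable_crossing_gf:
  fixes v :: real
  assumes v: "\<bar>v\<bar> \<le> 1"
  shows "integrable M (\<lambda>\<omega>. v ^ total_crossings X m \<omega> * of_bool (extinction_time X \<omega> < \<infinity>))"
proof (rule integrable_const_bound[where B = 1])
  have "(\<lambda>\<omega>. v ^ total_crossings X m \<omega>) \<in> borel_measurable M"
    by (rule measurable_compose[OF total_crossings_measurable]) simp
  moreover have "(\<lambda>\<omega>. of_bool (extinction_time X \<omega> < \<infinity>) :: real) \<in> borel_measurable M"
    by (rule measurable_compose[OF _ measurable_of_bool]) (simp only: Measurable.pred_def extinction_event)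
  ultimately show "(\<lambda>\<omega>. v ^ total_crossings X m \<omega> * of_bool (extinction_time X \<omega> < \<infinity>)) \<in> borel_measurable M"
    by (rule borel_measurable_times)
qed (use v in \<open>auto simp: power_abs power_le_one\<close>)

lemma gf_event_weight_absorbed:
  assumes \<omega>: "\<omega> \<in> space M" "absorbed (\<lambda>t. X t \<omega>)" and T: "0 < T" "X T \<omega> = 0"
  shows "extinction_time X \<omega> < \<infinity>"
    and "card {s. 0 < s \<and> s \<le> T \<and> jump_at (\<lambda>t. X t \<omega>) (int m - 1) s} = total_crossings X m \<omega>"
proof -
  note x = X_regular[OF \<omega>(1)]
  obtain s where s: "extinction_time X \<omega> = ereal s" "0 \<le> s" "s \<le> T" "X s \<omega> = 0"
    using extinction_time_attained[OF x _ T(2)] T by auto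
  then show "extinction_time X \<omega> < \<infinity>" by simp
  have zero: "X t \<omega> = 0" if "s \<le> t" for t
    using \<omega>(2) s that unfolding absorbed_def by blast
  have "\<not> jump_at (\<lambda>t. X t \<omega>) (int m - 1) r" if "s < r" for r
  proof -
    have "((\<lambda>t. X t \<omega>) \<longlongrightarrow> 0) (at_left r)"
      by (rule tendsto_eventually, rule eventually_mono[OF eventually_at_left_real[OF that]])
      (auto intro: zero)
    then have "l = 0" if "((\<lambda>t. X t \<omega>) \<longlongrightarrow> l) (at_left r)" for l
      using that by (intro tendsto_unique[of "at_left r" "\<lambda>t. X t \<omega>"]) auto
    then show ?thesis using zero[of r] that m_gt_1 by (auto simp: jump_at_def)
  qed
  then have "{r. 0 < r \<and> r \<le> T \<and> jump_at (\<lambda>t. X t \<omega>) (int m - 1) r} =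
      {r. 0 < r \<and> ereal r \<le> extinction_time X \<omega> \<and> jump_at (\<lambda>t. X t \<omega>) (int m - 1) r}"
    using s by (fastforce simp: not_less[symmetric])
  then show "card {s. 0 < s \<and> s \<le> T \<and> jump_at (\<lambda>t. X t \<omega>) (int m - 1) s} = total_crossings X m \<omega>"
    by (simp add: total_crossings_def crossings_def)
qed

lemma gf_event_weight_le:
  assumes v: "0 \<le> v" "v \<le> 1" and T: "0 < T"
  shows "(\<integral>\<omega>. gf_event_weight v T N \<omega> \<partial>M) \<le> crossing_gf v"
  unfolding crossing_gf_def
proof (rule integral_mono_AE)
  show "integrable M (gf_event_weight v T N)"
    by (rule integrable_const_bound[where B = 1])
    (use v gf_event_weight_limit(1)[OF v T] in \<open>auto simp: gf_event_weight_def power_le_one\<close>)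
  show "integrable M (\<lambda>\<omega>. v ^ total_crossings X m \<omega> * of_bool (extinction_time X \<omega> < \<infinity>))"
    using v by (intro integrable_crossing_gf) auto
  show "AE \<omega> in M. gf_event_weight v T N \<omega> \<le> v ^ total_crossings X m \<omega> * of_bool (extinction_time X \<omega> < \<infinity>)"
    using AE_absorbed AE_space
  proof eventually_elim
    case (elim \<omega>)
    then show ?case
      using gf_event_weight_absorbed[OF elim(2,1) T] v by (cases "X T \<omega> = 0")
      (auto simp: gf_event_weight_def)
  qed
qed

text \<open>Horizon and level can grow together: a path that dies out is bounded up to extinction
  and 0 afterwards, so both restrictions are eventually void. A path that never dies out contributes
  0 throughout.\<close>

lemma gf_event_weight_tendsto:
  assumes v: "0 \<le> v" "v \<le> 1"
  shows "(\<lambda>k. \<integral>\<omega>. gf_event_weight v (real (Suc k)) (Suc k) \<omega> \<partial>M) \<longlonglongrightarrow> crossing_gf v"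
  unfolding crossing_gf_def
proof (rule integral_dominated_convergence[where w = "\<lambda>_. 1"])
  show "(\<lambda>\<omega>. v ^ total_crossings X m \<omega> * of_bool (extinction_time X \<omega> < \<infinity>)) \<in> borel_measurable M"
    using integrable_crossing_gf[of v] v by auto
  show "gf_event_weight v (real (Suc k)) (Suc k) \<in> borel_measurable M" for k
    by (rule gf_event_weight_limit(1)[OF v]) simp
  show "AE \<omega> in M. norm (gf_event_weight v (real (Suc k)) (Suc k) \<omega>) \<le> 1" for k
    using v by (auto simp: gf_event_weight_def power_le_one)
  show "AE \<omega> in M. (\<lambda>k. gf_event_weight v (real (Suc k)) (Suc k) \<omega>) \<longlonglongrightarrow>
      v ^ total_crossings X m \<omega> * of_bool (extinction_time X \<omega> < \<infinity>)"
    using AE_absorbed AE_space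
  proof eventually_elim
    case (elim \<omega>)
    note x = X_regular[OF elim(2)]
    have "\<forall>\<^sub>F k in sequentially. gf_event_weight v (real (Suc k)) (Suc k) \<omega> =
      v ^ total_crossings X m \<omega> * of_bool (extinction_time X \<omega> < \<infinity>)"
    proof (cases "extinction_time X \<omega> < \<infinity>")
      case False
      then have "X (real (Suc k)) \<omega> \<noteq> 0" for k
        using extinction_time_finite_iff[OF x] by (metis of_nat_0_le_iff)
      then show ?thesis using False by (simp add: gf_event_weight_def)
    next
      case True
      then obtain t where t: "0 \<le> t" "X t \<omega> = 0" using extinction_time_finite_iff[OF x] by blast
      have zero: "X s \<omega> = 0" if "t \<le> s" for s
        using elim(1) t that unfolding absorbed_def by blast
      obtain B where B': "\<And>s. 0 \<le> s \<Longrightarrow> s \<le> t \<Longrightarrow> X s \<omega> \<le> B"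
        using regular_path_bounded[OF x t(1)] by blast
      have B: "X s \<omega> \<le> B" if "0 \<le> s" for s
        using B'[OF that] zero[of s] by (cases "s \<le> t") auto
      show ?thesis
        using eventually_ge_at_top[of B] eventually_ge_at_top[of "nat \<lceil>t\<rceil>"]
      proof eventually_elim
        case (elim k)
        have "t \<le> real (Suc k)" using elim(2) by linarith
        then have z: "X (real (Suc k)) \<omega> = 0" by (rule zero)
        have "X s \<omega> \<le> Suc k" if "0 \<le> s" for s using B[OF that] elim(1) by simp
        then show ?case
          using gf_event_weight_absorbed[OF \<open>\<omega> \<in> space M\<close> \<open>absorbed (\<lambda>t. X t \<omega>)\<close> _ z] z
          by (simp add: gf_event_weight_def)
      qed
    qed
    then show ?case by (rule tendsto_eventually)
  qed
qed simp

section \<open>The series B_v and the two estimates for F\<close>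

definition B_weighted :: "real \<Rightarrow> real \<Rightarrow> real" where
  "B_weighted v u = (\<Sum>k. b k * (if k = m then v else 1) * u ^ k)"

lemma b_sums: "b sums 0"
  and b_nonneg: "j \<noteq> 1 \<Longrightarrow> 0 \<le> b j"
  and b_1: "b 1 < 0"
  and w_pos: "1 \<le> i \<Longrightarrow> 0 < w i"
proof -
  note r = rates[unfolded branching_rates_def]
  show "j \<noteq> 1 \<Longrightarrow> 0 \<le> b j" "b 1 < 0" "1 \<le> i \<Longrightarrow> 0 < w i" using r by auto
  have "(\<lambda>j. (if j = 1 then 0 else b j) + (if j = 1 then b 1 else 0)) sums (- b 1 + b 1)"
    using r sums_single[of 1 "\<lambda>_. b 1"] by (intro sums_add) auto
  moreover have "(\<lambda>j. (if j = 1 then 0 else b j) + (if j = 1 then b 1 else 0)) = b" by auto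
  ultimately show "b sums 0" by simp
qed

lemma b_abs_summable: "summable (\<lambda>j. \<bar>b j\<bar>)"
proof -
  have "summable (\<lambda>j. (if j = 1 then - b 1 else 0) + (if j = 1 then 0 else b j))"
    using rates[unfolded branching_rates_def] sums_single[of 1 "\<lambda>_. - b 1"]
    by (intro summable_add) (auto dest: sums_summable)
  moreover have "(\<lambda>j. (if j = 1 then - b 1 else 0) + (if j = 1 then 0 else b j)) = (\<lambda>j. \<bar>b j\<bar>)"
    using b_nonneg b_1 by (auto simp: fun_eq_iff)
  ultimately show ?thesis by simp
qed

lemma summable_b_bounded:
  assumes "\<And>k. \<bar>c k\<bar> \<le> 1" shows "summable (\<lambda>k. b k * c k)"
proof (rule summable_comparison_test'[OF b_abs_summable, of 0])
  fix k show "norm (b k * c k) \<le> \<bar>b k\<bar>"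
    using mult_left_mono[OF assms[of k], of "\<bar>b k\<bar>"] by (simp add: abs_mult)
qed

lemma B_weighted_sums:
  assumes "\<bar>v\<bar> \<le> 1" "\<bar>u\<bar> \<le> 1"
  shows "(\<lambda>k. b k * (if k = m then v else 1) * u ^ k) sums B_weighted v u"
proof -
  have "summable (\<lambda>k. b k * ((if k = m then v else 1) * u ^ k))"
    using assms by (intro summable_b_bounded)
    (auto simp: abs_mult power_abs power_le_one mult_le_one)
  then show ?thesis unfolding B_weighted_def by (simp add: summable_sums mult.assoc)
qed

lemma B_weighted_diff:
  assumes "\<bar>v\<bar> \<le> 1" "\<bar>v'\<bar> \<le> 1" "\<bar>u\<bar> \<le> 1"
  shows "B_weighted v u - B_weighted v' u = (v - v') * b m * u ^ m"
proof -
  have "(\<lambda>k. b k * (if k = m then v else 1) * u ^ k - b k * (if k = m then v' else 1) * u ^ k) sums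
      (B_weighted v u - B_weighted v' u)"
    by (intro sums_diff B_weighted_sums assms)
  moreover have "(\<lambda>k. b k * (if k = m then v else 1) * u ^ k - b k * (if k =
      m then v' else 1) * u ^ k) =
      (\<lambda>k. if k = m then (v - v') * b m * u ^ m else 0)"
    by (auto simp: fun_eq_iff algebra_simps)
  ultimately show ?thesis
    using sums_single[of m "\<lambda>_. (v - v') * b m * u ^ m"] sums_unique2 by force
qed

lemma B_weighted_1_1: "B_weighted 1 1 = 0"
  unfolding B_weighted_def using b_sums by (simp add: sums_iff)

lemma generator_0: "generator v N \<phi> 0 = 0"
  by (simp add: generator_def branching_Q_0)

lemma generator_eq:
  assumes i: "1 \<le> i" "i \<le> N"
  shows "generator v N \<phi> i = w i * (\<Sum>k\<le>Suc N - i. b k * (if k = m then v else 1) * \<phi> (k + i - 1))"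
proof -
  have "(\<Sum>k\<le>Suc N - i. b k * (if k = m then v else 1) * \<phi> (k + i - 1)) =
      (\<Sum>j\<in>{i - 1..N}. b (j + 1 - i) * (if j + 1 = i + m then v else 1) * \<phi> j)"
    by (rule sum.reindex_bij_witness[of _ "\<lambda>j. j + 1 - i" "\<lambda>k. k + i - 1"]) (use i in auto)
  then have "w i * (\<Sum>k\<le>Suc N - i. b k * (if k = m then v else 1) * \<phi> (k + i - 1)) =
      (\<Sum>j\<in>{i - 1..N}. w i * (b (j + 1 - i) * (if j + 1 = i + m then v else 1) * \<phi> j))"
    by (simp add: sum_distrib_left)
  also have "\<dots> = generator v N \<phi> i"
    unfolding generator_def
    by (rule sum.mono_neutral_cong_left) (use i in \<open>auto simp: branching_Q_def step_weight_def\<close>)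
  finally show ?thesis by simp
qed

text \<open>Truncation drops the jumps beyond \<open>N\<close>, so the finite sum stays below a full
  series whose tail is nonnegative. The series \<open>g\<close> may be larger than the actual terms,
  and is chosen to have a computable sum.\<close>

lemma generator_le:
  assumes i: "1 \<le> i" "i \<le> N" and g: "g sums S"
    and le: "\<And>k. k \<le> Suc N - i \<Longrightarrow> b k * (if k = m then v else 1) * \<phi> (k + i - 1) \<le> g k"
    and nn: "\<And>k. Suc N - i < k \<Longrightarrow> 0 \<le> g k"
  shows "generator v N \<phi> i \<le> w i * S"
proof -
  have "(\<Sum>k\<le>Suc N - i. b k * (if k = m then v else 1) * \<phi> (k + i - 1)) \<le> (\<Sum>k\<le>Suc N - i. g k)"
    by (rule sum_mono) (use le in auto)
  also have "\<dots> \<le> S"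
    using sum_le_suminf[of g "{..Suc N - i}"] g nn by (simp add: sums_iff)
  finally show ?thesis unfolding generator_eq[OF i] using w_pos[OF i(1)] by simp
qed

text \<open>\<open>u\<^sup>i\<close> is superharmonic for the generator with jumps of size \<open>m - 1\<close> weighted by \<open>v\<close>.\<close>

lemma crossing_gf_le:
  assumes v: "0 \<le> v" "v \<le> 1" and u: "0 < u" "u \<le> 1" and B: "B_weighted v u \<le> 0"
  shows "crossing_gf v \<le> u"
proof -
  have gen: "generator v N (\<lambda>i. u ^ i) i \<le> 0" if "i \<le> N" for N i
  proof (cases "i = 0")
    case False
    have "generator v N (\<lambda>i. u ^ i) i \<le> w i * (B_weighted v u * u ^ (i - 1))"
    proof (rule generator_le)
      show "(\<lambda>k. b k * (if k = m then v else 1) * u ^ k * u ^ (i - 1)) sums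
          (B_weighted v u * u ^ (i - 1))"
        by (intro sums_mult2 B_weighted_sums) (use u v in auto)
      fix k
      show "b k * (if k = m then v else 1) * u ^ (k + i - 1) \<le> b k * (if k =
          m then v else 1) * u ^ k * u ^ (i - 1)"
      proof -
        have e: "k + i - 1 = k + (i - 1)" using False by simp
        show ?thesis unfolding e power_add by simp
      qed
      assume "Suc N - i < k"
      \<comment> \<open>The only negative coefficient is b_1, the diagonal one, and it is never
        among the dropped terms.\<close>
      then have "k \<noteq> 1" using that by auto
      then show "0 \<le> b k * (if k = m then v else 1) * u ^ k * u ^ (i - 1)"
        using b_nonneg[of k] u v by simp
    qed (use False that in auto)
    also have "\<dots> \<le> 0"
      using w_pos[of i] False B u by (simp add: mult_le_0_iff)
    finally show ?thesis .
  qed (simp add: generator_0)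
  \<comment> \<open>The generator bound is not strict. The slack \<epsilon> u^i makes it so, at the
    price of a factor exp(\<epsilon> T) that tends to 1 as \<epsilon> does to 0 with T
    fixed.\<close>
  have step: "(\<integral>\<omega>. gf_event_weight v T N \<omega> \<partial>M) \<le> exp (\<epsilon> * T) * u"
    if \<epsilon>: "0 < \<epsilon>" and T: "0 < T" and N: "1 \<le> N" for T N \<epsilon>
  proof (rule LIMSEQ_le_const2[OF gf_event_weight_limit(2)[OF v T]])
    have "\<forall>\<^sub>F h in at_right 0. \<forall>i\<le>N. weighted_step v N h (\<lambda>i. u ^ i) i \<le> (1 + \<epsilon> * h) * u ^ i"
    proof (rule eventually_weighted_step_le, rule disjI1)
      fix i assume "i \<le> N"
      then show "generator v N (\<lambda>i. u ^ i) i < \<epsilon> * u ^ i" using gen[of i N] \<epsilon> u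
        by (smt (verit) mult_pos_pos zero_less_power)
    qed
    from eventually_mesh[OF T this] eventually_gt_at_top[of 0]
    have "\<forall>\<^sub>F n in sequentially. skeleton v N (T / real n) n (\<lambda>i. of_bool (i =
        0)) \<le> exp (\<epsilon> * T) * u"
    proof eventually_elim
      case (elim n)
      have h: "0 < T / real n" using elim T by simp
      then have nn: "0 \<le> 1 + \<epsilon> * (T / real n)" using mult_pos_pos[OF \<epsilon> h] by linarith
      have "skeleton v N (T / real n) n (\<lambda>i. of_bool (i =
          0)) \<le> skeleton v N (T / real n) n (\<lambda>i. u ^ i)"
        by (rule skeleton_mono) (use h v u in auto)
      also have "\<dots> \<le> (1 + \<epsilon> * (T / real n)) ^ n * u ^ 1"
        by (rule skeleton_le_power) (use h v N elim nn in auto)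
      also have "(1 + \<epsilon> * (T / real n)) ^ n \<le> exp (\<epsilon> * (T / real n)) ^ n"
        by (rule power_mono) (use nn exp_ge_add_one_self in auto)
      also have "exp (\<epsilon> * (T / real n)) ^ n = exp (\<epsilon> * T)"
        using elim by (simp add: exp_of_nat_mult[symmetric])
      finally show ?case using u by (simp add: mult_right_mono)
    qed
    then show "\<exists>N'. \<forall>n\<ge>N'. skeleton v N (T / real n) n (\<lambda>i. of_bool (i = 0)) \<le> exp (\<epsilon> * T) * u"
      by (simp add: eventually_at_top_linorder)
  qed
  have "(\<integral>\<omega>. gf_event_weight v T N \<omega> \<partial>M) \<le> u" if T: "0 < T" and N: "1 \<le> N" for T N
  proof -
    have "((\<lambda>\<epsilon>. exp (\<epsilon> * T) * u) \<longlongrightarrow> exp (0 * T) * u) (at_right 0)" by (intro tendsto_intros)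
    then have "(\<integral>\<omega>. gf_event_weight v T N \<omega> \<partial>M) \<le> exp (0 * T) * u"
      by (rule tendsto_lowerbound)
        (use step[OF _ T N] eventually_at_right_less[of "0::real"] in \<open>auto elim!: eventually_mono\<close>)
    then show ?thesis by simp
  qed
  then show ?thesis
    by (intro LIMSEQ_le_const2[OF gf_event_weight_tendsto[OF v]]) auto
qed

text \<open>\<open>f\<^sup>i - f\<^bsup>N+1\<^esup>\<close> is subharmonic and negative above \<open>N\<close>, so the killing there
  does not spoil it; \<open>1 - \<delta>\<^sup>i\<close> decays exponentially, so the chain confined to
  \<open>{1..N}\<close> dies out.\<close>

lemma crossing_gf_ge:
  assumes v: "0 \<le> v" "v < 1" and f: "0 < f" "f < 1" and B: "B_weighted v f = 0"
    and b0: "0 < b 0" and bm: "0 \<le> b m"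
  shows "f \<le> crossing_gf v"
proof -
  have v': "0 \<le> v" "v \<le> 1" using v by auto
  \<comment> \<open>With this choice the diagonal term cancels half of the downward one: -b_0
    \<delta>^(i-1) - b_1 \<delta>^i = -b_0 \<delta>^(i-1) / 2. Since b_0 \<le> -b_1, also \<delta>
    \<le> 1/2.\<close>
  define \<delta> where "\<delta> = b 0 / (2 * (- b 1))"
  have "(\<Sum>k\<in>{0, 1}. b k) \<le> 0"
    using sum_le_suminf[of b "{0, 1}"] b_sums b_nonneg by (auto simp: sums_iff)
  then have \<delta>: "0 < \<delta>" "\<delta> \<le> 1/2" using b0 b_1 by (auto simp: \<delta>_def field_simps)
  have b1\<delta>: "b 1 * \<delta> = - b 0 / 2" using b_1 by (simp add: \<delta>_def field_simps)
  define \<theta> where "\<theta> i = 1 - \<delta> ^ i" for i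
  have \<theta>: "\<theta> i \<le> 1" "0 \<le> \<theta> i" for i
    using \<delta> by (auto simp: \<theta>_def power_le_one)
  have \<theta>_half: "1/2 \<le> \<theta> i" if "1 \<le> i" for i
    using power_decreasing[OF that, of \<delta>] \<delta> by (simp add: \<theta>_def)
  \<comment> \<open>The sign is reversed because the iteration lemma yields upper bounds
    only.\<close>
  define \<psi> where "\<psi> N i = - (f ^ i - f ^ Suc N)" for N i :: nat
  have gen_\<theta>: "generator v N \<theta> i \<le> w i * (- (\<delta> ^ (i - 1) * b 0 / 2))" if i: "1 \<le> i" "i \<le> N" for N i
  proof -
    \<comment> \<open>The exact terms for \<open>k = 0\<close> and \<open>k = 1\<close>, and
      \<open>\<theta> \<le> 1\<close> for all others; so the series is that of b, with sum 0, up to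
      two corrections.\<close>
    define g where "g k = b k - (if k = 0 then b 0 * \<delta> ^ (i - 1) else 0) - (if k =
        1 then b 1 * \<delta> ^ i else 0)" for k
    have "g sums (0 - b 0 * \<delta> ^ (i - 1) - b 1 * \<delta> ^ i)"
      unfolding g_def
      using sums_single[of 0 "\<lambda>_. b 0 * \<delta> ^ (i - 1)"] sums_single[of 1 "\<lambda>_. b 1 * \<delta> ^ i"]
      by (intro sums_diff b_sums) auto
    then have "generator v N \<theta> i \<le> w i * (0 - b 0 * \<delta> ^ (i - 1) - b 1 * \<delta> ^ i)"
    proof (rule generator_le[OF i])
      fix k :: nat
      consider "k = 0" | "k = 1" | "2 \<le> k" by linarith
      then show "b k * (if k = m then v else 1) * \<theta> (k + i - 1) \<le> g k"
      proof cases
        case 3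
        have "(if k = m then v else 1) * \<theta> (k + i - 1) \<le> 1"
          using v \<theta>[of "k + i - 1"] by (auto intro: mult_le_one)
        from mult_left_mono[OF this b_nonneg[of k]] 3 show ?thesis by (simp add: g_def mult.assoc)
      qed (use m_gt_1 i in \<open>auto simp: g_def \<theta>_def algebra_simps\<close>)
      assume "Suc N - i < k"
      then have "2 \<le> k" using i by auto
      then show "0 \<le> g k" using b_nonneg[of k] by (simp add: g_def)
    qed
    also have "b 1 * \<delta> ^ i = b 1 * \<delta> * \<delta> ^ (i - 1)" using i by (cases i) auto
    finally show ?thesis unfolding b1\<delta> by (simp add: algebra_simps)
  qed
  have gen_\<psi>: "generator v N (\<psi> N) i \<le> 0" if i: "i \<le> N" for N i
  proof (cases "i = 0")
    case False
    \<comment> \<open>The factor \<open>1 ^ k\<close> exhibits the constant part as the series of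
      B_v at 1, which is at most 0; the other part is the series at the root
      \<open>f\<close>.\<close>
    define g where "g k = f ^ Suc N * (b k * (if k = m then v else 1) * 1 ^ k) - b k * (if k =
        m then v else 1) * f ^ k * f ^ (i - 1)" for k
    have g_alt: "g k = b k * (if k = m then v else 1) * \<psi> N (k + i - 1)" for k
    proof -
      have e: "k + i - 1 = k + (i - 1)" using False by simp
      show ?thesis unfolding e by (simp add: g_def \<psi>_def power_add algebra_simps)
    qed
    have "g sums (f ^ Suc N * B_weighted v 1 - B_weighted v f * f ^ (i - 1))"
      unfolding g_def
      by (intro sums_diff sums_mult sums_mult2 B_weighted_sums) (use v f in auto)
    then have "generator v N (\<psi> N) i \<le> w i * (f ^ Suc N * B_weighted v 1 - B_weighted v f * f ^ (i - 1))"
    proof (rule generator_le[rotated 2])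
      fix k assume k: "Suc N - i < k"
      then have "f ^ (k + i - 1) \<le> f ^ Suc N" using i f by (intro power_decreasing) auto
      then show "0 \<le> g k" unfolding g_alt \<psi>_def using k i b_nonneg[of k] v
        by (intro mult_nonneg_nonneg) auto
    qed (use False i g_alt in auto)
    also have "B_weighted v 1 = - ((1 - v) * b m)"
      using B_weighted_diff[of v 1 1] B_weighted_1_1 v by (simp add: algebra_simps)
    also have "w i * (f ^ Suc N * - ((1 - v) * b m) - B_weighted v f * f ^ (i - 1)) \<le> 0"
      using B w_pos[of i] False f v bm by (simp add: mult_le_0_iff zero_le_mult_iff)
    finally show ?thesis .
  qed (simp add: generator_0)
  \<comment> \<open>The rate \<open>c\<close> may depend on \<open>N\<close> but not on
    \<open>T\<close>, which allows \<open>T\<close> to go to infinity for fixed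
    \<open>N\<close>.\<close>
  have bound: "\<exists>c>0. \<forall>T>0. f - f ^ Suc N - 2 * exp (- c * T) \<le> (\<integral>\<omega>. gf_event_weight v T N \<omega> \<partial>M)"
    if N: "1 \<le> N" for N
  proof -
    \<comment> \<open>Half of the decay obtained for \<open>\<theta>\<close>, minimised over the
      finitely many living states; the other half is the strict slack.\<close>
    define c where "c = Min ((\<lambda>i. w i * (\<delta> ^ (i - 1) * b 0 / 4)) ` {1..N})"
    have c_le: "c \<le> w i * (\<delta> ^ (i - 1) * b 0 / 4)" if "1 \<le> i" "i \<le> N" for i
      unfolding c_def using that by (intro Min_le) auto
    have pos: "0 < w i * (\<delta> ^ (i - 1) * b 0 / 4)" if "1 \<le> i" for i
      using w_pos[OF that] \<delta> b0 by simp
    have c: "0 < c" unfolding c_def using N pos by (subst Min_gr_iff) auto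
    have step_\<theta>: "\<forall>\<^sub>F h in at_right 0. \<forall>i\<le>N. weighted_step v N h \<theta> i \<le> (1 + - c * h) * \<theta> i"
    proof (rule eventually_weighted_step_le)
      fix i assume i: "i \<le> N"
      show "generator v N \<theta> i < - c * \<theta> i \<or> (\<forall>h\<ge>0. weighted_step v N h \<theta> i \<le> (1 + - c * h) * \<theta> i)"
      proof (cases "i = 0")
        case True
        have "weighted_step v N h \<theta> 0 = 0" if "0 \<le> h" for h
          unfolding weighted_step_def
          by (rule sum.neutral) (use that in \<open>auto simp: p_absorbing \<theta>_def\<close>)
        then show ?thesis using True by (simp add: \<theta>_def)
      next
        case False
        have "generator v N \<theta> i \<le> - 2 * (w i * (\<delta> ^ (i - 1) * b 0 / 4))"
          using gen_\<theta>[of i N] False i by (simp add: mult_ac)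
        also have "\<dots> < - (w i * (\<delta> ^ (i - 1) * b 0 / 4))" using pos[of i] False
          by (simp add: mult_ac)
        also have "\<dots> \<le> - c" using c_le[of i] False i by simp
        also have "\<dots> \<le> - c * \<theta> i" using \<theta>[of i] c by (simp add: mult_left_le)
        finally show ?thesis by blast
      qed
    qed
    have step: "(1 - \<epsilon> * T) * (f - f ^ Suc N) - 2 * exp (- c * T) \<le> (\<integral>\<omega>. gf_event_weight v T N \<omega> \<partial>M)"
      if T: "0 < T" and \<epsilon>: "0 < \<epsilon>" for \<epsilon> T
    proof (rule LIMSEQ_le_const[OF gf_event_weight_limit(2)[OF v' T]])
      have step_\<psi>: "\<forall>\<^sub>F h in at_right 0. \<forall>i\<le>N. weighted_step v N h (\<psi> N) i \<le> (1 + - \<epsilon> * h) * \<psi> N i"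
      proof (rule eventually_weighted_step_le, rule disjI1)
        fix i assume i: "i \<le> N"
        then have "f ^ Suc N < f ^ i" using f by (intro power_strict_decreasing) auto
        then have "\<psi> N i < 0" unfolding \<psi>_def by simp
        then have "0 < - \<epsilon> * \<psi> N i" using \<epsilon> by (simp add: mult_pos_neg)
        then show "generator v N (\<psi> N) i < - \<epsilon> * \<psi> N i" using gen_\<psi>[OF i] by linarith
      qed
      have "((\<lambda>h. (c + \<epsilon>) * h) \<longlongrightarrow> (c + \<epsilon>) * 0) (at_right 0)" by (intro tendsto_intros)
      then have small: "\<forall>\<^sub>F h in at_right 0. (c + \<epsilon>) * h < 1"
        by (rule order_tendstoD) simp
      from eventually_mesh[OF T step_\<theta>] eventually_mesh[OF T step_\<psi>] eventually_mesh[OF T small] eventually_gt_at_top[of 0]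
      have "\<forall>\<^sub>F n in sequentially.
          (1 - \<epsilon> * T) * (f - f ^ Suc N) - 2 * exp (- c * T) \<le> skeleton v N (T / real n) n (\<lambda>i. of_bool (i = 0))"
      proof eventually_elim
        case (elim n)
        define h where "h = T / real n"
        have h: "0 < h" "real n * h = T" using elim T by (auto simp: h_def)
        have ch: "0 \<le> c * h" "0 \<le> \<epsilon> * h" using c \<epsilon> h by auto
        have "(c + \<epsilon>) * h < 1" using elim by (simp add: h_def)
        then have small: "c * h + \<epsilon> * h < 1" by (simp add: distrib_right)
        have nn: "0 \<le> 1 + - c * h" "0 \<le> 1 + - \<epsilon> * h" "- 1 \<le> - \<epsilon> * h"
          using ch small by linarith+
        have st: "\<forall>i\<le>N. weighted_step v N h \<theta> i \<le> (1 + - c * h) * \<theta> i"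
          "\<forall>i\<le>N. weighted_step v N h (\<psi> N) i \<le> (1 + - \<epsilon> * h) * \<psi> N i"
          unfolding h_def by (rule elim)+
        \<comment> \<open>Pointwise, f^i - f^(N+1) is at most the indicator of 0 plus 2 \<theta>_i.
          The factor 2 matches \<open>\<theta> i \<ge> 1/2\<close> on living states, so the
          survivors are charged to the decaying \<open>\<theta>\<close>.\<close>
        have "skeleton v N h n (\<lambda>i. - 1 * of_bool (i = 0)) \<le> skeleton v N h n (\<lambda>i. \<psi> N i + 2 * \<theta> i)"
        proof (rule skeleton_mono[OF h(1) v(1)])
          fix i
          have "f ^ i \<le> 1" "0 < f ^ Suc N" using f by (auto simp: power_le_one simp del: power_Suc)
          then show "- 1 * of_bool (i = 0) \<le> \<psi> N i + 2 * \<theta> i"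
            using \<theta>_half[of i] by (cases "i = 0") (auto simp: \<psi>_def \<theta>_def simp del: power_Suc)
        qed
        also have "\<dots> = skeleton v N h n (\<psi> N) + 2 * skeleton v N h n \<theta>"
          using skeleton_add[OF h(1), of v N n "\<psi> N" "\<lambda>i. 2 * \<theta> i"] by (simp add: skeleton_scale)
        finally have "- skeleton v N h n (\<lambda>i. of_bool (i =
            0)) \<le> skeleton v N h n (\<psi> N) + 2 * skeleton v N h n \<theta>"
          unfolding skeleton_scale by simp
        moreover have "skeleton v N h n \<theta> \<le> exp (- c * T)"
        proof -
          have "skeleton v N h n \<theta> \<le> (1 + - c * h) ^ n * \<theta> 1"
            by (rule skeleton_le_power[OF h(1) v(1) N nn(1)]) (use st in blast)
          also have "\<dots> \<le> (1 + - c * h) ^ n * 1"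
            using \<theta>[of 1] nn by (intro mult_left_mono) simp_all
          also have "(1 + - c * h) ^ n \<le> exp (- c * h) ^ n"
            by (rule power_mono[OF exp_ge_add_one_self nn(1)])
          also have "exp (- c * h) ^ n = exp (- c * T)"
            using h by (simp add: exp_of_nat_mult[symmetric] mult_ac)
          finally show ?thesis by simp
        qed
        moreover have "skeleton v N h n (\<psi> N) \<le> (1 - \<epsilon> * T) * \<psi> N 1"
        proof -
          have "skeleton v N h n (\<psi> N) \<le> (1 + - \<epsilon> * h) ^ n * \<psi> N 1"
            by (rule skeleton_le_power[OF h(1) v(1) N nn(2)]) (use st in blast)
          \<comment> \<open>Multiplication by the nonpositive \<open>\<psi> N 1\<close> turns
            Bernoulli's lower bound into an upper bound.\<close>
          also have "\<dots> \<le> (1 + real n * (- \<epsilon> * h)) * \<psi> N 1"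
          proof (rule mult_right_mono_neg)
            show "1 + real n * (- \<epsilon> * h) \<le> (1 + - \<epsilon> * h) ^ n"
              by (rule Bernoulli_inequality) (rule nn)
            show "\<psi> N 1 \<le> 0" using power_decreasing[of 1 "Suc N" f] f
              by (simp add: \<psi>_def del: power_Suc)
          qed
          also have "real n * (- \<epsilon> * h) = - \<epsilon> * T" using h by (simp add: mult_ac)
          finally show ?thesis by simp
        qed
        ultimately show ?case unfolding h_def[symmetric] by (simp add: \<psi>_def algebra_simps)
      qed
      then show "\<exists>N'. \<forall>n\<ge>N'. (1 - \<epsilon> * T) * (f - f ^ Suc N) - 2 * exp (- c * T) \<le> skeleton v N (T / real n) n (\<lambda>i. of_bool (i = 0))"
        by (simp add: eventually_at_top_linorder)
    qed
    have "f - f ^ Suc N - 2 * exp (- c * T) \<le> (\<integral>\<omega>. gf_event_weight v T N \<omega> \<partial>M)" if T: "0 < T" for T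
    proof -
      have "((\<lambda>\<epsilon>. (1 - \<epsilon> * T) * (f - f ^ Suc N) - 2 * exp (- c * T)) \<longlongrightarrow>
          (1 - 0 * T) * (f - f ^ Suc N) - 2 * exp (- c * T)) (at_right 0)"
        by (intro tendsto_intros)
      then have "(1 - 0 * T) * (f - f ^ Suc N) - 2 * exp (- c * T) \<le> (\<integral>\<omega>. gf_event_weight v T N \<omega> \<partial>M)"
        by (rule tendsto_upperbound)
          (use step[OF T] eventually_at_right_less[of "0::real"] in \<open>auto elim!: eventually_mono\<close>)
      then show ?thesis by simp
    qed
    then show ?thesis using c by blast
  qed
  \<comment> \<open>The error from survivors disappears with T first; only then is \<open>N\<close>
    sent to infinity to remove f^(N+1).\<close>
  have "f - f ^ Suc N \<le> crossing_gf v" if N: "1 \<le> N" for N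
  proof -
    obtain c where c: "0 < c" "\<And>T. 0 < T \<Longrightarrow>
        f - f ^ Suc N - 2 * exp (- c * T) \<le> (\<integral>\<omega>. gf_event_weight v T N \<omega> \<partial>M)"
      using bound[OF N] by blast
    have "((\<lambda>T. f - f ^ Suc N - 2 * exp (- c * T)) \<longlongrightarrow> f - f ^ Suc N - 2 * 0) at_top"
    proof (intro tendsto_intros filterlim_compose[OF exp_at_bot])
      show "LIM T at_top. - c * T :> at_bot"
        using c filterlim_tendsto_neg_mult_at_bot[OF tendsto_const[of "- c"] _ filterlim_ident]
        by simp
    qed
    then have "f - f ^ Suc N - 2 * 0 \<le> crossing_gf v"
    proof (rule tendsto_upperbound)
      show "\<forall>\<^sub>F T in at_top. f - f ^ Suc N - 2 * exp (- c * T) \<le> crossing_gf v"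
        using eventually_gt_at_top[of 0]
        by eventually_elim (use c(2) gf_event_weight_le[OF v'] order_trans in blast)
    qed simp
    then show ?thesis by simp
  qed
  moreover have "(\<lambda>N. f - f ^ Suc N) \<longlonglongrightarrow> f - 0"
    using f by (intro tendsto_intros LIMSEQ_Suc LIMSEQ_realpow_zero) auto
  ultimately have "f - 0 \<le> crossing_gf v" by (intro LIMSEQ_le_const2) auto
  then show ?thesis by simp
qed

section \<open>The crossing probabilities as coefficients of F\<close>

definition crossing_prob :: "nat \<Rightarrow> real" where
  "crossing_prob k = prob {\<omega> \<in> space M. total_crossings X m \<omega> = k \<and> extinction_time X \<omega> < \<infinity>}"

text \<open>For a fixed outcome at most one term is nonzero, and the probabilities of the disjoint
  events are summable. This justifies exchanging sum and integral for all
  \<open>\<bar>v\<bar> \<le> 1\<close>, including negative \<open>v\<close>.\<close>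

lemma crossing_gf_sums:
  assumes v: "\<bar>v\<bar> \<le> 1"
  shows "(\<lambda>k. crossing_prob k * v ^ k) sums crossing_gf v"
proof -
  define A where "A k = {\<omega> \<in> space M. total_crossings X m \<omega> = k \<and> extinction_time X \<omega> < \<infinity>}" for k
  have "{\<omega> \<in> space M. total_crossings X m \<omega> = k} \<in> events" for k
    using measurable_sets[OF total_crossings_measurable, of "{k}"]
    by (simp add: vimage_def Int_def conj_commute)
  then have A: "A k \<in> events" for k
    unfolding A_def using extinction_event by (intro sets.sets_Collect_conj)
  have "(\<lambda>k. prob (A k)) sums prob (\<Union>k. A k)"
    using A by (intro finite_measure_UNION) (auto simp: disjoint_family_on_def A_def)
  then have sm: "summable (\<lambda>k. prob (A k))" by (rule sums_summable)
  define f where "f k \<omega> = v ^ k * indicator (A k) \<omega>" for k \<omega>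
  have f_single: "f k \<omega> = (if k =
      total_crossings X m \<omega> then v ^ total_crossings X m \<omega> * of_bool (extinction_time X \<omega> < \<infinity>) else 0)"
    if "\<omega> \<in> space M" for k \<omega>
    using that by (auto simp: f_def A_def indicator_def)
  have f_sums: "(\<lambda>k. f k \<omega>) sums (v ^ total_crossings X m \<omega> * of_bool (extinction_time X \<omega> < \<infinity>))"
    if "\<omega> \<in> space M" for \<omega>
    unfolding f_single[OF that]
    using sums_single[of "total_crossings X m \<omega>" "\<lambda>_. v ^ total_crossings X m \<omega> * of_bool (extinction_time X \<omega> < \<infinity>)"] .
  have f_int: "integrable M (f k)" for k
    unfolding f_def
    by (intro integrable_mult_right integrable_real_indicator A) (simp add: emeasure_eq_measure)
  have f_norm: "(\<integral>\<omega>. norm (f k \<omega>) \<partial>M) = \<bar>v\<bar> ^ k * prob (A k)" for k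
    using A by (simp add: f_def abs_mult power_abs Int_absorb2 sets.sets_into_space)
  have "(\<lambda>k. \<integral>\<omega>. f k \<omega> \<partial>M) sums (\<integral>\<omega>. (\<Sum>k. f k \<omega>) \<partial>M)"
  proof (rule sums_integral[OF f_int])
    show "AE \<omega> in M. summable (\<lambda>k. norm (f k \<omega>))"
    proof (rule AE_I2)
      fix \<omega> assume "\<omega> \<in> space M"
      then show "summable (\<lambda>k. norm (f k \<omega>))"
        by (intro summable_finite[of "{total_crossings X m \<omega>}"]) (auto simp: f_single)
    qed
    show "summable (\<lambda>k. \<integral>\<omega>. norm (f k \<omega>) \<partial>M)"
      unfolding f_norm
      by (rule summable_comparison_test'[OF sm, of 0])
      (use v in \<open>auto simp: abs_mult power_le_one mult_left_le_one_le\<close>)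
  qed
  also have "(\<integral>\<omega>. (\<Sum>k. f k \<omega>) \<partial>M) = crossing_gf v"
    unfolding crossing_gf_def
    by (intro Bochner_Integration.integral_cong refl) (use f_sums in \<open>simp add: sums_iff\<close>)
  also have "(\<lambda>k. \<integral>\<omega>. f k \<omega> \<partial>M) = (\<lambda>k. crossing_prob k * v ^ k)"
  proof
    fix k
    have "crossing_prob k = prob (A k)" by (simp only: crossing_prob_def A_def)
    then show "(\<integral>\<omega>. f k \<omega> \<partial>M) = crossing_prob k * v ^ k"
      using A by (simp add: f_def Int_absorb2 sets.sets_into_space mult.commute)
  qed
  finally show ?thesis .
qed

lemma crossing_prob_nonneg: "0 \<le> crossing_prob k"
  by (simp add: crossing_prob_def)

lemma crossing_gf_1: "crossing_gf 1 = prob {\<omega> \<in> space M. extinction_time X \<omega> < \<infinity>}"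
proof -
  have "crossing_gf 1 = (\<integral>\<omega>. indicator {\<omega> \<in> space M. extinction_time X \<omega> < \<infinity>} \<omega> \<partial>M)"
    unfolding crossing_gf_def by (intro Bochner_Integration.integral_cong)
    (auto simp: indicator_def)
  then show ?thesis by (simp add: Int_absorb2)
qed

lemma crossing_gf_continuous: "continuous_on {0..1} crossing_gf"
proof -
  have "continuous_on {0..1} (\<lambda>u. \<Sum>k. crossing_prob k * u ^ k)"
    by (rule power_series_continuous_on_unit)
      (use crossing_gf_sums[of 1] crossing_prob_nonneg in \<open>simp add: sums_iff\<close>)
  moreover have "(\<Sum>k. crossing_prob k * u ^ k) = crossing_gf u" if "u \<in> {0..1}" for u
    using crossing_gf_sums[of u] that by (simp add: sums_iff)
  ultimately show ?thesis by (rule continuous_on_eq)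
qed

lemma B_weighted_continuous:
  assumes "\<bar>v\<bar> \<le> 1" shows "continuous_on {0..1} (B_weighted v)"
  unfolding B_weighted_def
  by (rule power_series_continuous_on_unit, rule summable_comparison_test'[OF b_abs_summable, of 0])
    (use assms in \<open>auto simp: abs_mult mult_left_le\<close>)

section \<open>F(v) as the minimal root of B_v\<close>

lemma B_weighted_0: "B_weighted v 0 = b 0"
  using powser_zero[of "\<lambda>k. b k * (if k = m then v else 1)"] m_gt_1 by (simp add: B_weighted_def)

text \<open>If b_0 = 0, then u^k \<le> u for k \<ge> 2, with equality at the negative coefficient k
  = 1, gives B(u) \<le> u B(1) = 0 for every u in (0, 1]. The upper estimate then bounds the
  extinction probability by each such u.\<close>

lemma b_0_pos:
  assumes "0 < prob {\<omega> \<in> space M. extinction_time X \<omega> < \<infinity>}"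
  shows "0 < b 0"
proof (rule ccontr)
  assume "\<not> 0 < b 0"
  then have b0: "b 0 = 0" using b_nonneg[of 0] by simp
  have "crossing_gf 1 \<le> u" if u: "0 < u" "u \<le> 1" for u
  proof (rule crossing_gf_le)
    have "b k * (if k = m then 1 else 1) * u ^ k \<le> b k * u" for k
    proof -
      consider "k = 0" | "k = 1" | "2 \<le> k" by linarith
      then show ?thesis
      proof cases
        case 3
        then have "u ^ k \<le> u ^ 1" using u by (intro power_decreasing) auto
        then show ?thesis using b_nonneg[of k] 3 by (simp add: mult_left_mono)
      qed (use b0 in auto)
    qed
    moreover have "(\<lambda>k. b k * u) sums (0 * u)" by (intro sums_mult2 b_sums)
    ultimately have "B_weighted 1 u \<le> 0 * u"
      using u by (intro sums_le[OF _ B_weighted_sums]) auto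
    then show "B_weighted 1 u \<le> 0" by simp
  qed (use u in auto)
  note le = this
  have "0 < crossing_gf 1" "crossing_gf 1 \<le> 1" using assms
    by (simp_all only: crossing_gf_1 prob_le_1)
  then have "crossing_gf 1 \<le> crossing_gf 1 / 2" by (intro le) auto
  then show False using \<open>0 < crossing_gf 1\<close> by simp
qed

text \<open>B_v changes sign from b_0 > 0 at 0 to -(1 - v) b_m < 0 at 1. A root in between satisfies
  the hypotheses of both estimates, hence equals F(v).\<close>

lemma crossing_gf_root:
  assumes v: "0 \<le> v" "v < 1" and b0: "0 < b 0" and bm: "0 < b m"
  shows "0 < crossing_gf v" "crossing_gf v < 1" "B_weighted v (crossing_gf v) = 0"
proof -
  have neg: "B_weighted v 1 < 0"
    using B_weighted_diff[of v 1 1] B_weighted_1_1 v bm by (simp add: mult_neg_pos)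
  obtain f where f: "0 \<le> f" "f \<le> 1" "B_weighted v f = 0"
    using IVT2'[of "B_weighted v" 1 0 0] B_weighted_continuous[of v] neg B_weighted_0[of v] b0 v
    by auto
  have "f \<noteq> 0" "f \<noteq> 1" using f B_weighted_0[of v] b0 neg by auto
  then have f': "0 < f" "f < 1" using f by auto
  have "crossing_gf v = f"
    using crossing_gf_le[of v f] crossing_gf_ge[OF v f' f(3) b0] f f' bm v by simp
  then show "0 < crossing_gf v" "crossing_gf v < 1" "B_weighted v (crossing_gf v) = 0" using f' f
    by auto
qed

text \<open>The minimal root may now be 1, out of reach of the lower estimate. Instead v tends to 1
  from the left in B_1(F(v)) = (1 - v) b_m F(v)^m.\<close>

lemma crossing_gf_root_1:
  assumes b0: "0 < b 0" and bm: "0 < b m"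
  shows "0 \<le> crossing_gf 1" "crossing_gf 1 \<le> 1" "B_weighted 1 (crossing_gf 1) = 0"
proof -
  show F1: "0 \<le> crossing_gf 1" "crossing_gf 1 \<le> 1" by (simp_all add: crossing_gf_1)
  have F: "(crossing_gf \<longlongrightarrow> crossing_gf 1) (at_left 1)"
    using crossing_gf_continuous[unfolded continuous_on_def, rule_format, of 1]
    by (simp add: at_within_Icc_at_left)
  have ev: "\<forall>\<^sub>F v in at_left (1::real). 0 < v \<and> v < 1"
    by (auto simp: eventually_at_left_field intro!: exI[of _ 0])
  have "((\<lambda>v. B_weighted 1 (crossing_gf v)) \<longlongrightarrow> B_weighted 1 (crossing_gf 1)) (at_left 1)"
  proof (rule continuous_on_tendsto_compose[OF _ F])
    show "continuous_on {0..1} (B_weighted 1)" by (rule B_weighted_continuous) simp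
    show "crossing_gf 1 \<in> {0..1}" using F1 by simp
    show "\<forall>\<^sub>F v in at_left 1. crossing_gf v \<in> {0..1}"
      using ev
    proof eventually_elim
      case (elim v)
      then show ?case using crossing_gf_root(1,2)[OF _ _ b0 bm, of v] by simp
    qed
  qed
  moreover have "((\<lambda>v. (1 - v) * b m * crossing_gf v ^ m) \<longlongrightarrow>
      (1 - 1) * b m * crossing_gf 1 ^ m) (at_left 1)"
    by (intro tendsto_intros F)
  then have "((\<lambda>v. B_weighted 1 (crossing_gf v)) \<longlongrightarrow> (1 - 1) * b m * crossing_gf 1 ^ m) (at_left 1)"
  proof (rule Lim_transform_eventually)
    show "\<forall>\<^sub>F v in at_left 1. (1 - v) * b m * crossing_gf v ^ m = B_weighted 1 (crossing_gf v)"
    using ev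
  proof eventually_elim
    case (elim v)
    then show ?case
      using B_weighted_diff[of 1 v "crossing_gf v"] crossing_gf_root[OF _ _ b0 bm, of v] by simp
    qed
  qed
  ultimately have "B_weighted 1 (crossing_gf 1) = (1 - 1) * b m * crossing_gf 1 ^ m"
    by (rule tendsto_unique[OF trivial_limit_at_left_real])
  then show "B_weighted 1 (crossing_gf 1) = 0" by simp
qed

text \<open>Every root is an upper bound of F(v) by the superharmonic estimate. The root 0, which
  that estimate does not admit, is excluded by b_0 > 0.\<close>

lemma min_nonneg_root_eq:
  assumes v: "0 \<le> v" "v \<le> 1" and b0: "0 < b 0"
    and F: "0 \<le> crossing_gf v" "crossing_gf v \<le> 1" "B_weighted v (crossing_gf v) = 0"
  shows "min_nonneg_root (B_weighted v) = crossing_gf v"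
  unfolding min_nonneg_root_def
proof (rule Least_equality)
  fix u assume u: "0 \<le> u \<and> u \<le> 1 \<and> B_weighted v u = 0"
  then have "u \<noteq> 0" using B_weighted_0[of v] b0 by auto
  then show "crossing_gf v \<le> u" using u v by (intro crossing_gf_le) auto
qed (use F in auto)

lemma Bm_fun_eq: "Bm_fun b m = B_weighted 0"
  unfolding fun_eq_iff Bm_fun_def B_weighted_def
  by (intro allI arg_cong[where f = suminf] ext) simp

lemma B_fun_eq: "B_fun b = B_weighted 1"
  by (simp add: fun_eq_iff B_fun_def B_weighted_def)

text \<open>A convex function that is negative at \<open>1\<close> has negative slope at any smaller root.\<close>

lemma Bm_fun_deriv_nonzero:
  assumes r: "0 \<le> r" "r < 1" "Bm_fun b m r = 0" and bm: "0 < b m"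
  shows "deriv (Bm_fun b m) r \<noteq> 0"
proof
  assume d: "deriv (Bm_fun b m) r = 0"
  let ?\<beta> = "\<lambda>i. b i * (if i = m then 0 else 1)"
  have "(\<lambda>i. real i * (if i = m then 0 else b i) * r ^ (i - 1)) sums 0"
    using Bm_fun_deriv(2)[OF b_abs_summable, of r m] r(1,2) unfolding d by simp
  then have S: "(\<lambda>i. real i * (if i = m then 0 else b i) * r ^ (i - 1) * (1 - r)) sums
      (0 * (1 - r))"
    by (rule sums_mult2)
  have S': "(\<lambda>i. ?\<beta> i * 1 ^ i - ?\<beta> i * r ^ i) sums (B_weighted 0 1 - B_weighted 0 r)"
    by (intro sums_diff B_weighted_sums) (use r(1,2) in auto)
  \<comment> \<open>The tangent inequality i r^(i-1) (1 - r) \<le> 1 - r^i, term by term. It is an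
    equality at \<open>i = 1\<close>, so the negative sign of b_1 does no harm.\<close>
  have le: "real i * (if i =
      m then 0 else b i) * r ^ (i - 1) * (1 - r) \<le> ?\<beta> i * 1 ^ i - ?\<beta> i * r ^ i" for i
  proof (cases "i = 1")
    case False
    have "(\<Sum>j<i. r ^ (i - 1)) \<le> (\<Sum>j<i. r ^ j)"
      by (rule sum_mono, rule power_decreasing) (use r(1,2) in auto)
    then have "(1 - r) * (real i * r ^ (i - 1)) \<le> (1 - r) * (\<Sum>j<i. r ^ j)"
      using r(2) by (intro mult_left_mono) simp_all
    also have "\<dots> = 1 - r ^ i" by (simp add: one_diff_power_eq)
    finally have "b i * ((1 - r) * (real i * r ^ (i - 1))) \<le> b i * (1 - r ^ i)"
      by (rule mult_left_mono[OF _ b_nonneg[OF False]])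
    also have "b i * ((1 - r) * (real i * r ^ (i - 1))) = real i * b i * r ^ (i - 1) * (1 - r)"
      by (simp only: mult_ac)
    also have "b i * (1 - r ^ i) = b i * 1 * 1 ^ i - b i * 1 * r ^ i"
      by (simp add: right_diff_distrib)
    finally show ?thesis by (cases "i = m") (simp_all only: if_True if_False, simp)
  qed (use m_gt_1 in \<open>simp add: right_diff_distrib\<close>)
  have "0 * (1 - r) \<le> B_weighted 0 1 - B_weighted 0 r"
    by (rule sums_le[OF le S S'])
  also have "B_weighted 0 1 = - b m" using B_weighted_diff[of 0 1 1] B_weighted_1_1 by simp
  finally show False using bm r by (simp add: Bm_fun_eq)
qed

lemma crossing_prob_eq_rho_seq:
  assumes b0: "0 < b 0" and bm: "0 < b m"
  shows "rho_seq b m k = crossing_prob k"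
proof (rule rho_seq_eqI[where F = crossing_gf, OF b_abs_summable m_gt_1 crossing_prob_nonneg])
  \<comment> \<open>At v = 0 only the constant term survives, because
    \<open>0 ^ 0 = 1\<close>.\<close>
  have a0: "crossing_prob 0 = crossing_gf 0"
    using crossing_gf_sums[of 0] powser_sums_zero_iff[of crossing_prob] by simp
  note r0 = crossing_gf_root[OF _ _ b0 bm, of 0]
  show "crossing_prob 0 = min_nonneg_root (Bm_fun b m)"
    unfolding a0 Bm_fun_eq by (rule min_nonneg_root_eq[symmetric]) (use b0 r0 in auto)
  show "crossing_prob 0 < 1" unfolding a0 using r0 by simp
  show "deriv (Bm_fun b m) (crossing_prob 0) \<noteq> 0"
    unfolding a0 by (rule Bm_fun_deriv_nonzero) (use r0 bm in \<open>auto simp: Bm_fun_eq\<close>)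
  fix v :: real assume v: "0 < v" "v < 1"
  note r = crossing_gf_root[OF less_imp_le[OF v(1)] v(2) b0 bm]
  show "(\<lambda>k. crossing_prob k * v ^ k) sums crossing_gf v" by (rule crossing_gf_sums) (use v in auto)
  show "crossing_gf v \<le> 1" using r by simp
  show "Bm_fun b m (crossing_gf v) + v * b m * crossing_gf v ^ m = 0"
    using B_weighted_diff[of v 0 "crossing_gf v"] r v by (simp add: Bm_fun_eq)
qed

end

section \<open>The law of the crossing number conditioned on extinction\<close>

theorem corollary3p2:
  fixes M :: "'a measure" and X :: "real \<Rightarrow> 'a \<Rightarrow> nat"
    and b w :: "nat \<Rightarrow> real" and m :: nat
  assumes "weighted_branching_process M X b w"
    and "AE \<omega> in M. X 0 \<omega> = 1"
    and "1 < m" and "0 < b m"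
    and "0 < \<P>(\<omega> in M. extinction_time X \<omega> < \<infinity>)"
  shows "(\<forall>v::real. \<bar>v\<bar> \<le> 1 \<longrightarrow>
            summable (\<lambda>k. rho_seq b m k * v ^ k) \<and>
            (LINT \<omega>|uniform_measure M {\<omega> \<in> space M. extinction_time X \<omega> < \<infinity>}.
               v ^ total_crossings X m \<omega>) =
            inverse (min_nonneg_root (B_fun b)) * (\<Sum>k. rho_seq b m k * v ^ k)) \<and>
         (\<forall>k. \<P>(\<omega> in M. total_crossings X m \<omega> = k \<bar> extinction_time X \<omega> < \<infinity>) =
            inverse (min_nonneg_root (B_fun b)) * rho_seq b m k)"
proof -
  obtain p where p: "transition_function p" "has_Q_matrix p (branching_Q b w)" "markov_property M X p"
    and chain: "branching_rates b w" "prob_space M"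
      "\<And>t. 0 \<le> t \<Longrightarrow> X t \<in> measurable M (count_space UNIV)"
      "\<And>\<omega>. \<omega> \<in> space M \<Longrightarrow> regular_path (\<lambda>t. X t \<omega>)"
    using assms(1) unfolding weighted_branching_process_def regular_markov_chain_def by blast
  interpret branching_chain M X p b w m
    by (intro branching_chain.intro branching_chain_axioms.intro) (use p chain assms in auto)
  let ?A = "{\<omega> \<in> space M. extinction_time X \<omega> < \<infinity>}"
  have b0: "0 < b 0" by (rule b_0_pos) (rule assms(5))
  \<comment> \<open>F(1) is the extinction probability, so the minimal root of B is exactly the
    normalising constant of the conditioning.\<close>
  have root: "min_nonneg_root (B_fun b) = prob ?A"
    unfolding B_fun_eq crossing_gf_1[symmetric]
    by (rule min_nonneg_root_eq) (use b0 crossing_gf_root_1[OF b0 assms(4)] in auto)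
  note rho = crossing_prob_eq_rho_seq[OF b0 assms(4)]
  show ?thesis
  proof (intro conjI allI impI)
    fix v :: real assume v: "\<bar>v\<bar> \<le> 1"
    note sums = crossing_gf_sums[OF v]
    show "summable (\<lambda>k. rho_seq b m k * v ^ k)"
      unfolding rho using sums by (rule sums_summable)
    have "(\<lambda>\<omega>. v ^ total_crossings X m \<omega>) \<in> borel_measurable M"
      by (rule measurable_compose[OF total_crossings_measurable]) simp
    then have "(LINT \<omega>|uniform_measure M ?A. v ^ total_crossings X m \<omega>) =
        (\<integral>\<omega>. v ^ total_crossings X m \<omega> * indicator ?A \<omega> \<partial>M) / prob ?A"
      by (rule integral_uniform_measure) (use assms(5) extinction_event in auto)
    also have "(\<integral>\<omega>. v ^ total_crossings X m \<omega> * indicator ?A \<omega> \<partial>M) = crossing_gf v"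
      unfolding crossing_gf_def by (intro Bochner_Integration.integral_cong)
      (auto simp: indicator_def)
    finally show "(LINT \<omega>|uniform_measure M ?A. v ^ total_crossings X m \<omega>) =
        inverse (min_nonneg_root (B_fun b)) * (\<Sum>k. rho_seq b m k * v ^ k)"
      using sums by (simp add: rho root sums_iff field_simps)
  next
    fix k
    show "\<P>(\<omega> in M. total_crossings X m \<omega> = k \<bar> extinction_time X \<omega> < \<infinity>) =
        inverse (min_nonneg_root (B_fun b)) * rho_seq b m k"
      unfolding cond_prob_def rho root crossing_prob_def by (simp add: field_simps)
  qed
qed

end
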